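(* Let $\mu,a\in\mathbb{C}\setminus\{0\}$. The operators $\mu D$ and $T_a$ on $H(\mathbb{C})$ possess a common hypercyclic subspace; that is, there exists a closed infinite-dimensional linear subspace $M\subset H(\mathbb{C})$ such that every $f\in M\setminus\{0\}$ is hypercyclic for both $\mu D$ and $T_a$.
   Context: $H(\mathbb{C})$ is the Fréchet space of entire functions with the topology of uniform convergence on compact subsets of $\mathbb{C}$. The operators $D$ and $T_a$ on $H(\mathbb{C})$ are defined by $Df=f'$ and $(T_af)(z)=f(z+a)$. A vector $x$ is hypercyclic for a continuous linear operator $T$ on a Fréchet space $X$ if its orbit $\{T^nx:n\ge 0\}$ is dense in $X$. A common hypercyclic subspace for a family of operators is a closed infinite-dimensional subspace in which each non-zero vector is hypercyclic for each operator of the family. *)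

theory Defs
  imports "HOL-Complex_Analysis.Complex_Analysis" "HOL-Library.Function_Algebras"
begin

section \<open>The space of entire functions\<close>

definition entire_functions :: "(complex \<Rightarrow> complex) set" where
  "entire_functions = {f. f holomorphic_on UNIV}"

definition entire_open :: "(complex \<Rightarrow> complex) set \<Rightarrow> bool" where
  "entire_open U \<longleftrightarrow> U \<subseteq> entire_functions \<and>
     (\<forall>f\<in>U. \<exists>K e. compact K \<and> e > 0 \<and>
        {g \<in> entire_functions. \<forall>z\<in>K. dist (g z) (f z) < e} \<subseteq> U)"

text \<open>The topology of uniform convergence on compact sets. The type of all functions already
  carries the product topology (pointwise convergence) in HOL-Analysis; that one is not used here,
  so \<open>closed\<close>, \<open>closure\<close> and the like must be taken relative to this abstract topology.\<close>

definition entire_topology :: "(complex \<Rightarrow> complex) topology" where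
  "entire_topology = topology entire_open"

lemma entire_openE:
  assumes "entire_open U" and "f \<in> U"
  obtains K e where "compact K" "e > 0"
    "{g \<in> entire_functions. \<forall>z\<in>K. dist (g z) (f z) < e} \<subseteq> U"
  using assms unfolding entire_open_def by blast

lemma istopology_entire_open: "istopology entire_open"
  unfolding istopology_def
proof (intro conjI allI impI)
  fix S T assume S: "entire_open S" and T: "entire_open T"
  show "entire_open (S \<inter> T)"
    unfolding entire_open_def
  proof (intro conjI ballI)
    show "S \<inter> T \<subseteq> entire_functions" using S by (auto simp: entire_open_def)
    fix f assume f: "f \<in> S \<inter> T"
    obtain K d where K: "compact K" "d > 0"
      "{g \<in> entire_functions. \<forall>z\<in>K. dist (g z) (f z) < d} \<subseteq> S"
      using S f by (elim IntE) (rule entire_openE)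
    obtain L e where L: "compact L" "e > 0"
      "{g \<in> entire_functions. \<forall>z\<in>L. dist (g z) (f z) < e} \<subseteq> T"
      using T f by (elim IntE) (rule entire_openE)
    have "{g \<in> entire_functions. \<forall>z\<in>K \<union> L. dist (g z) (f z) < min d e} \<subseteq> S \<inter> T"
      using K(3) L(3) by auto
    moreover have "compact (K \<union> L)" "min d e > 0" using K L by auto
    ultimately show "\<exists>K e. compact K \<and> e > 0 \<and>
        {g \<in> entire_functions. \<forall>z\<in>K. dist (g z) (f z) < e} \<subseteq> S \<inter> T" by blast
  qed
next
  fix \<K> assume a: "\<forall>S\<in>\<K>. entire_open S"
  show "entire_open (\<Union>\<K>)"
    unfolding entire_open_def
  proof (intro conjI ballI)
    show "\<Union>\<K> \<subseteq> entire_functions" using a by (auto simp: entire_open_def)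
    fix f assume "f \<in> \<Union>\<K>"
    then obtain S where S: "S \<in> \<K>" "f \<in> S" by blast
    then have "entire_open S" using a by blast
    then obtain K e where "compact K" "e > 0"
      "{g \<in> entire_functions. \<forall>z\<in>K. dist (g z) (f z) < e} \<subseteq> S"
      using S(2) by (rule entire_openE)
    then show "\<exists>K e. compact K \<and> e > 0 \<and>
        {g \<in> entire_functions. \<forall>z\<in>K. dist (g z) (f z) < e} \<subseteq> \<Union>\<K>"
      using S(1) by blast
  qed
qed

lemma openin_entire_topology: "openin entire_topology = entire_open"
  unfolding entire_topology_def using istopology_entire_open by (rule topology_inverse')

lemma topspace_entire_topology [simp]: "topspace entire_topology = entire_functions"
proof -
  have "entire_open entire_functions"
    unfolding entire_open_def by (intro conjI ballI exI[of _ "{}"] exI[of _ "1::real"]) auto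
  moreover have "U \<subseteq> entire_functions" if "entire_open U" for U
    using that by (simp add: entire_open_def)
  ultimately show ?thesis
    unfolding topspace_def openin_entire_topology by blast
qed

lemma openin_entire_basic:
  assumes f: "f \<in> entire_functions" and K: "compact K"
  shows "openin entire_topology {g \<in> entire_functions. \<forall>z\<in>K. dist (g z) (f z) < e}"
  unfolding openin_entire_topology entire_open_def
proof (intro conjI ballI)
  fix g assume "g \<in> {g \<in> entire_functions. \<forall>z\<in>K. dist (g z) (f z) < e}"
  then have g: "g \<in> entire_functions" "\<And>z. z \<in> K \<Longrightarrow> dist (g z) (f z) < e" by auto
  show "\<exists>L d. compact L \<and> d > 0 \<and> {h \<in> entire_functions. \<forall>z\<in>L. dist (h z) (g z) < d}
          \<subseteq> {g \<in> entire_functions. \<forall>z\<in>K. dist (g z) (f z) < e}"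
  proof (cases "K = {}")
    case True
    then show ?thesis by (intro exI[of _ "{}"] exI[of _ "1::real"]) auto
  next
    case False
    have "continuous_on K f" "continuous_on K g"
      using f g(1) unfolding entire_functions_def mem_Collect_eq
      by (meson continuous_on_subset holomorphic_on_imp_continuous_on subset_UNIV)+
    then have "continuous_on K (\<lambda>z. dist (g z) (f z))"
      by (intro continuous_on_dist)
    then obtain w where w: "w \<in> K" "\<And>z. z \<in> K \<Longrightarrow> dist (g z) (f z) \<le> dist (g w) (f w)"
      using continuous_attains_sup[OF K False] by blast
    define d where "d = e - dist (g w) (f w)"
    have "d > 0" using g(2)[OF w(1)] by (simp add: d_def)
    moreover have "dist (h z) (f z) < e" if "z \<in> K" "dist (h z) (g z) < d" for h z
      using dist_triangle[of "h z" "f z" "g z"] w(2)[OF that(1)] that(2) by (simp add: d_def)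
    ultimately show ?thesis using K by (intro exI[of _ K] exI[of _ d]) auto
  qed
qed auto

lemma limitin_entire_topology:
  "limitin entire_topology f l F \<longleftrightarrow>
     l \<in> entire_functions \<and> (\<forall>\<^sub>F n in F. f n \<in> entire_functions) \<and>
     (\<forall>K. compact K \<longrightarrow> uniform_limit K f l F)"
proof (intro iffI conjI allI impI)
  assume lim: "limitin entire_topology f l F"
  show l: "l \<in> entire_functions" using limitin_topspace[OF lim] by simp
  show "\<forall>\<^sub>F n in F. f n \<in> entire_functions"
  proof -
    have "openin entire_topology entire_functions"
      using openin_topspace[of entire_topology] by simp
    then show ?thesis using lim l unfolding limitin_def by blast
  qed
  fix K :: "complex set" assume K: "compact K"
  show "uniform_limit K f l F"
    unfolding uniform_limit_iff
  proof (intro allI impI)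
    fix e :: real assume "e > 0"
    then have "l \<in> {g \<in> entire_functions. \<forall>z\<in>K. dist (g z) (l z) < e}" using l by simp
    then have "\<forall>\<^sub>F n in F. f n \<in> {g \<in> entire_functions. \<forall>z\<in>K. dist (g z) (l z) < e}"
      using lim openin_entire_basic[OF l K, of e] unfolding limitin_def by blast
    then show "\<forall>\<^sub>F n in F. \<forall>z\<in>K. dist (f n z) (l z) < e"
      by (rule eventually_mono) simp
  qed
next
  assume a: "l \<in> entire_functions \<and> (\<forall>\<^sub>F n in F. f n \<in> entire_functions) \<and>
     (\<forall>K. compact K \<longrightarrow> uniform_limit K f l F)"
  show "limitin entire_topology f l F"
    unfolding limitin_def
  proof (intro conjI allI impI)
    show "l \<in> topspace entire_topology" using a by simp
    fix U assume "openin entire_topology U \<and> l \<in> U"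
    then obtain K e where K: "compact K" "e > 0"
      "{g \<in> entire_functions. \<forall>z\<in>K. dist (g z) (l z) < e} \<subseteq> U"
      unfolding openin_entire_topology by (elim conjE) (rule entire_openE)
    have "\<forall>\<^sub>F n in F. \<forall>z\<in>K. dist (f n z) (l z) < e"
      using a K(1,2) unfolding uniform_limit_iff by blast
    moreover have "\<forall>\<^sub>F n in F. f n \<in> entire_functions" using a by blast
    ultimately show "\<forall>\<^sub>F n in F. f n \<in> U"
      by eventually_elim (use K(3) in auto)
  qed
qed

global_interpretation cfun: vector_space "\<lambda>(c::complex) (f::complex \<Rightarrow> complex) z. c * f z"
  by unfold_locales (auto simp: algebra_simps fun_eq_iff)

lemma subspace_entire_functions: "cfun.subspace entire_functions"
  unfolding cfun.subspace_def entire_functions_def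
  by (auto simp: zero_fun_def plus_fun_def intro!: holomorphic_intros)


section \<open>Hypercyclic vectors and common hypercyclic subspaces\<close>

text \<open>The operator is given by a function on the whole type, of which only the restriction to
  \<open>topspace X\<close> is relevant. That the operators \<open>\<mu>D\<close> and \<open>T\<^sub>a\<close> restrict to continuous linear
  self-maps of the space of entire functions is shown at the end of this theory.\<close>

definition hypercyclic :: "'a topology \<Rightarrow> ('a \<Rightarrow> 'a) \<Rightarrow> 'a \<Rightarrow> bool" where
  "hypercyclic X T x \<longleftrightarrow>
     x \<in> topspace X \<and> X closure_of {(T ^^ n) x |n. True} = topspace X"

definition infinite_dimensional :: "(complex \<Rightarrow> complex) set \<Rightarrow> bool" where
  "infinite_dimensional M \<longleftrightarrow> \<not> (\<exists>B. finite B \<and> M = cfun.span B)"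

definition common_hypercyclic_subspace ::
  "((complex \<Rightarrow> complex) \<Rightarrow> (complex \<Rightarrow> complex)) set \<Rightarrow> (complex \<Rightarrow> complex) set \<Rightarrow> bool" where
  "common_hypercyclic_subspace \<F> M \<longleftrightarrow>
     cfun.subspace M \<and> closedin entire_topology M \<and> infinite_dimensional M \<and>
     (\<forall>f\<in>M - {0}. \<forall>T\<in>\<F>. hypercyclic entire_topology T f)"


section \<open>The operators\<close>

definition scaled_deriv_op :: "complex \<Rightarrow> (complex \<Rightarrow> complex) \<Rightarrow> complex \<Rightarrow> complex" where
  "scaled_deriv_op \<mu> f = (\<lambda>z. \<mu> * deriv f z)"

definition translation_op :: "complex \<Rightarrow> (complex \<Rightarrow> complex) \<Rightarrow> complex \<Rightarrow> complex" where
  "translation_op a f = (\<lambda>z. f (z + a))"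

lemma scaled_deriv_op_entire:
  "f \<in> entire_functions \<Longrightarrow> scaled_deriv_op \<mu> f \<in> entire_functions"
  unfolding entire_functions_def scaled_deriv_op_def by (auto intro!: holomorphic_intros)

lemma translation_op_entire:
  "f \<in> entire_functions \<Longrightarrow> translation_op a f \<in> entire_functions"
  unfolding entire_functions_def translation_op_def mem_Collect_eq
  by (rule holomorphic_on_compose_gen[of "\<lambda>z. z + a" UNIV f UNIV, unfolded o_def])
     (auto intro!: holomorphic_intros)

lemma scaled_deriv_op_linear:
  assumes "f \<in> entire_functions" "g \<in> entire_functions"
  shows "scaled_deriv_op \<mu> (\<lambda>z. c * f z + d * g z) =
           (\<lambda>z. c * scaled_deriv_op \<mu> f z + d * scaled_deriv_op \<mu> g z)"
proof -
  have "(f has_field_derivative deriv f z) (at z)" "(g has_field_derivative deriv g z) (at z)" for z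
    using assms unfolding entire_functions_def
    by (auto simp: holomorphic_on_def DERIV_deriv_iff_field_differentiable)
  then have "deriv (\<lambda>z. c * f z + d * g z) z = c * deriv f z + d * deriv g z" for z
    by (intro DERIV_imp_deriv)
       (auto intro!: derivative_eq_intros)
  then show ?thesis by (auto simp: scaled_deriv_op_def algebra_simps)
qed

lemma translation_op_linear:
  "translation_op a (\<lambda>z. c * f z + d * g z) =
     (\<lambda>z. c * translation_op a f z + d * translation_op a g z)"
  by (simp add: translation_op_def)

lemma continuous_map_entireI:
  assumes maps: "\<And>f. f \<in> entire_functions \<Longrightarrow> T f \<in> entire_functions"
    and bound: "\<And>K. compact K \<Longrightarrow> \<exists>L C. compact L \<and> C > 0 \<and>
      (\<forall>f\<in>entire_functions. \<forall>g\<in>entire_functions. \<forall>e>0.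
         (\<forall>z\<in>L. dist (g z) (f z) < e) \<longrightarrow> (\<forall>z\<in>K. dist (T g z) (T f z) < C * e))"
  shows "continuous_map entire_topology entire_topology T"
  unfolding continuous_map_def
proof (intro conjI allI impI)
  show "T \<in> topspace entire_topology \<rightarrow> topspace entire_topology" using maps by auto
  fix U assume U: "openin entire_topology U"
  show "openin entire_topology {f \<in> topspace entire_topology. T f \<in> U}"
    unfolding openin_entire_topology entire_open_def
  proof (intro conjI ballI)
    fix f assume "f \<in> {f \<in> topspace entire_topology. T f \<in> U}"
    then have f: "f \<in> entire_functions" "T f \<in> U" by auto
    obtain K e where K: "compact K" "e > 0"
      "{g \<in> entire_functions. \<forall>z\<in>K. dist (g z) (T f z) < e} \<subseteq> U"
      using U f(2) unfolding openin_entire_topology by (rule entire_openE)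
    obtain L C where L: "compact L" "C > 0" and LC:
      "\<forall>f\<in>entire_functions. \<forall>g\<in>entire_functions. \<forall>e>0.
         (\<forall>z\<in>L. dist (g z) (f z) < e) \<longrightarrow> (\<forall>z\<in>K. dist (T g z) (T f z) < C * e)"
      using bound[OF K(1)] by blast
    have "T g \<in> U" if g: "g \<in> entire_functions" "\<forall>z\<in>L. dist (g z) (f z) < e / C" for g
    proof -
      have "e / C > 0" using K(2) L(2) by simp
      then have "\<forall>z\<in>K. dist (T g z) (T f z) < C * (e / C)"
        using LC f(1) g by blast
      then have "\<forall>z\<in>K. dist (T g z) (T f z) < e" using L(2) by simp
      then show ?thesis using K(3) maps[OF g(1)] by blast
    qed
    then show "\<exists>L d. compact L \<and> d > 0 \<and>
        {g \<in> entire_functions. \<forall>z\<in>L. dist (g z) (f z) < d}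
          \<subseteq> {f \<in> topspace entire_topology. T f \<in> U}"
      using L K(2) by (intro exI[of _ L] exI[of _ "e / C"]) auto
  qed auto
qed

lemma continuous_map_translation_op:
  "continuous_map entire_topology entire_topology (translation_op a)"
proof (rule continuous_map_entireI)
  fix K :: "complex set" assume "compact K"
  then have "compact ((\<lambda>z. z + a) ` K)"
    by (intro compact_continuous_image continuous_intros)
  then show "\<exists>L C. compact L \<and> C > 0 \<and>
      (\<forall>f\<in>entire_functions. \<forall>g\<in>entire_functions. \<forall>e>0.
         (\<forall>z\<in>L. dist (g z) (f z) < e) \<longrightarrow>
         (\<forall>z\<in>K. dist (translation_op a g z) (translation_op a f z) < C * e))"
    by (intro exI[of _ "(\<lambda>z. z + a) ` K"] exI[of _ "1::real"]) (auto simp: translation_op_def)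
qed (rule translation_op_entire)

lemma continuous_map_scaled_deriv_op:
  "continuous_map entire_topology entire_topology (scaled_deriv_op \<mu>)"
proof (rule continuous_map_entireI)
  fix K :: "complex set" assume K: "compact K"
  define L where "L = {x + y | x y. x \<in> K \<and> y \<in> cball (0::complex) 1}"
  have L: "compact L" unfolding L_def by (intro compact_sums K compact_cball)
  have "dist (scaled_deriv_op \<mu> g z) (scaled_deriv_op \<mu> f z) < (norm \<mu> + 1) * e"
    if f: "f \<in> entire_functions" and g: "g \<in> entire_functions" and e: "e > 0"
      and le: "\<forall>z\<in>L. dist (g z) (f z) < e" and z: "z \<in> K" for f g e z
  proof -
    define h where "h = (\<lambda>z. g z - f z)"
    have "h holomorphic_on UNIV"
      using f g unfolding h_def entire_functions_def mem_Collect_eq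
      by (intro holomorphic_on_diff)
    then have hol: "h holomorphic_on S" for S
      by (rule holomorphic_on_subset) simp
    have "norm (h x) \<le> e" if "norm (z - x) = 1" for x
    proof -
      have "x = z + (x - z)" "x - z \<in> cball 0 1"
        using that by (simp_all add: norm_minus_commute)
      then have "x \<in> L" unfolding L_def using z by blast
      then show ?thesis using le by (auto simp: h_def dist_norm intro: less_imp_le)
    qed
    then have "norm ((deriv ^^ 1) h z) \<le> fact 1 * e / 1 ^ 1"
      by (intro Cauchy_inequality hol holomorphic_on_imp_continuous_on) auto
    then have "norm (deriv h z) \<le> e" by simp
    moreover have "deriv h z = deriv g z - deriv f z"
      unfolding h_def using f g by (intro deriv_diff)
        (auto simp: entire_functions_def holomorphic_on_def)
    ultimately have "norm (\<mu> * (deriv g z - deriv f z)) \<le> norm \<mu> * e"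
      by (simp add: norm_mult mult_left_mono)
    also have "\<dots> < (norm \<mu> + 1) * e" using e by (simp add: algebra_simps)
    finally show ?thesis by (simp add: scaled_deriv_op_def dist_norm algebra_simps)
  qed
  moreover have "norm \<mu> + 1 > 0" by (simp add: add_nonneg_pos)
  ultimately show "\<exists>L C. compact L \<and> C > 0 \<and>
      (\<forall>f\<in>entire_functions. \<forall>g\<in>entire_functions. \<forall>e>0.
         (\<forall>z\<in>L. dist (g z) (f z) < e) \<longrightarrow>
         (\<forall>z\<in>K. dist (scaled_deriv_op \<mu> g z) (scaled_deriv_op \<mu> f z) < C * e))"
    using L by (intro exI[of _ L] exI[of _ "norm \<mu> + 1"]) blast
qed (rule scaled_deriv_op_entire)

end

theory Submission
  imports Defs "HOL-Real_Asymp.Real_Asymp"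
begin

text \<open>
  Write \<open>h z = z * exp (- z / a)\<close>, so that \<open>h\<close> vanishes to order exactly one at \<open>0\<close>. The subspace
  is the closure \<open>M\<close> of the span of entire functions \<open>f i = e i + s i i + s (i+1) i + \<dots>\<close>. The seed
  \<open>e i\<close> is a polynomial close to \<open>h ^ m i\<close>, with lowest term \<open>z ^ m i\<close>, where the pivots \<open>m i\<close> grow
  very fast. The corrections \<open>s k i\<close> are polynomials that are tiny on ever larger discs. Stage \<open>k\<close> of
  the construction treats one task, made of an operator \<open>A\<close> of the family, an index \<open>j\<close> and a
  target polynomial \<open>p\<close>: it fixes a power \<open>n\<close> and chooses \<open>s k i\<close> for all \<open>i \<le> k\<close> such
  that \<open>A ^^ n\<close> maps \<open>f j\<close> close to \<open>p\<close>, if \<open>j \<le> k\<close>, and the other \<open>f i\<close>, \<open>i \<le> k\<close>, close to \<open>0\<close>. There are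
  countably many tasks, each of which is repeated infinitely often, so also at stages \<open>k \<ge> j\<close>.

  The \<open>m i\<close>-th Taylor coefficient is the \<open>i\<close>-th coordinate on the span, and Cauchy's inequality
  bounds it by \<open>b / R ^ m i\<close> if the function is bounded by \<open>b\<close> on the disc of radius \<open>R\<close>. So the
  coordinates are continuous and decay faster than \<open>R ^ (- m i)\<close> for every \<open>R\<close>, with a constant
  that depends only on a bound on a disc. The functions \<open>f i\<close> with \<open>i > k\<close>, which stage \<open>k\<close> cannot
  see, are therefore harmless if \<open>A ^^ n\<close> maps \<open>f i\<close> to something of size at most \<open>C ^ m i\<close> on the
  given disc, where \<open>C\<close> may depend on the operator and the disc, but not on \<open>k\<close> and \<open>i\<close>. Altogether
  \<open>A ^^ n\<close> maps \<open>g \<in> M\<close> to \<open>c * p\<close>, up to an error at most a multiple of \<open>(1/2) ^ k\<close>, where \<open>c\<close> is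
  the \<open>j\<close>-th coordinate of \<open>g\<close> (lemma \<open>M_steered\<close>). A non-zero \<open>g\<close> has a non-zero coordinate, and
  polynomials whose coefficients have rational real and imaginary parts are dense, so \<open>g\<close> is hypercyclic.

  Two properties of an operator make this work. It is \<open>steerable\<close>: high powers take a polynomial close to
  any prescribed polynomial after a tiny correction of high order at \<open>0\<close>. For \<open>\<mu>D\<close> the correction is an
  iterated antiderivative of the target; for \<open>T\<^sub>a\<close> it is an explicit polynomial which is small
  near \<open>0\<close> and has the desired values near \<open>n * a\<close>. It also \<open>tames\<close> the
  function \<open>h\<close>: the powers \<open>h ^ m\<close> are mapped to functions of size \<open>C ^ m\<close>. For \<open>\<mu>D\<close> this is
  Cauchy's inequality, since \<open>m\<close> is chosen after \<open>n\<close>; for \<open>T\<^sub>a\<close> it holds because \<open>h\<close> is bounded by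
  \<open>1\<close> on the disc of radius \<open>r\<close> about \<open>n * a\<close> as soon as \<open>n\<close> is large. Monomials would not do here:
  \<open>z ^ m\<close> has size \<open>\<bar>n * a\<bar> ^ m\<close> there, which is not of the form \<open>C ^ m\<close> uniformly in \<open>n\<close>.
\<close>

section \<open>Bounds on discs and Taylor coefficients\<close>

definition disc_bound :: "real \<Rightarrow> (complex \<Rightarrow> complex) \<Rightarrow> real \<Rightarrow> bool" where
  "disc_bound r f b \<longleftrightarrow> (\<forall>z. norm z \<le> r \<longrightarrow> norm (f z) \<le> b)"

lemma disc_boundD: "disc_bound r f b \<Longrightarrow> norm z \<le> r \<Longrightarrow> norm (f z) \<le> b"
  by (simp add: disc_bound_def)

lemma disc_bound_mono: "disc_bound r f b \<Longrightarrow> r' \<le> r \<Longrightarrow> b \<le> b' \<Longrightarrow> disc_bound r' f b'"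
  unfolding disc_bound_def by (meson order_trans)

lemma disc_bound_add:
  "disc_bound r f b \<Longrightarrow> disc_bound r g c \<Longrightarrow> disc_bound r (\<lambda>z. f z + g z) (b + c)"
  unfolding disc_bound_def by (meson add_mono norm_triangle_ineq order_trans)

lemma disc_bound_sum:
  "(\<And>i. i \<in> I \<Longrightarrow> disc_bound r (f i) (b i)) \<Longrightarrow> disc_bound r (\<lambda>z. \<Sum>i\<in>I. f i z) (sum b I)"
  unfolding disc_bound_def by (meson sum_norm_le)

lemma disc_bound_cmult:
  "disc_bound r f b \<Longrightarrow> norm c \<le> c' \<Longrightarrow> 0 \<le> b \<Longrightarrow> disc_bound r (\<lambda>z. c * f z) (c' * b)"
  unfolding disc_bound_def norm_mult by (meson mult_mono norm_ge_zero order_trans)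

lemma disc_bound_nonneg: "disc_bound r f b \<Longrightarrow> 0 \<le> r \<Longrightarrow> 0 \<le> b"
  using disc_boundD[of r f b 0] by (auto intro: order_trans[OF norm_ge_zero])

lemma entire_holomorphic: "f \<in> entire_functions \<Longrightarrow> f holomorphic_on S"
  unfolding entire_functions_def by (auto intro: holomorphic_on_subset)

lemma entire_continuous: "f \<in> entire_functions \<Longrightarrow> continuous_on S f"
  by (intro holomorphic_on_imp_continuous_on entire_holomorphic)

lemma entire_poly [simp]: "poly p \<in> entire_functions"
  unfolding entire_functions_def by (auto intro: holomorphic_intros)

lemma entire_lincomb:
  "f \<in> entire_functions \<Longrightarrow> g \<in> entire_functions \<Longrightarrow> (\<lambda>z. c * f z + d * g z) \<in> entire_functions"
  unfolding entire_functions_def by (auto intro!: holomorphic_intros)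

lemma entire_zero [simp]: "(\<lambda>z. 0) \<in> entire_functions"
  unfolding entire_functions_def by (auto intro!: holomorphic_intros)

lemma entire_diff:
  "f \<in> entire_functions \<Longrightarrow> g \<in> entire_functions \<Longrightarrow> (\<lambda>z. f z - g z) \<in> entire_functions"
  unfolding entire_functions_def by (auto intro!: holomorphic_intros)

lemma entire_sum:
  "(\<And>i. i \<in> I \<Longrightarrow> f i \<in> entire_functions) \<Longrightarrow> (\<lambda>z. \<Sum>i\<in>I. c i * f i z) \<in> entire_functions"
  unfolding entire_functions_def by (auto intro!: holomorphic_intros)

lemma entire_disc_bound_ex:
  assumes "f \<in> entire_functions"
  obtains b where "b \<ge> 1" "disc_bound r f b"
proof -
  have "compact (f ` cball 0 r)"
    by (intro compact_continuous_image entire_continuous assms compact_cball)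
  then obtain B where "\<And>x. x \<in> f ` cball 0 r \<Longrightarrow> norm x \<le> B"
    using compact_imp_bounded bounded_iff by metis
  then have "disc_bound r f (max 1 B)" by (auto simp: disc_bound_def le_max_iff_disj)
  then show thesis by (intro that[of "max 1 B"]) auto
qed

definition taylor_coeff :: "(complex \<Rightarrow> complex) \<Rightarrow> nat \<Rightarrow> complex" where
  "taylor_coeff f n = (deriv ^^ n) f 0 / fact n"

lemma taylor_sums: "f \<in> entire_functions \<Longrightarrow> (\<lambda>n. taylor_coeff f n * z ^ n) sums f z"
  using holomorphic_power_series[of f 0 "norm z + 1" z] entire_holomorphic[of f]
  by (simp add: taylor_coeff_def)

lemma entire_eqI_taylor:
  assumes "f \<in> entire_functions" "g \<in> entire_functions" "\<And>n. taylor_coeff f n = taylor_coeff g n"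
  shows "f = g"
proof
  fix z show "f z = g z"
    using taylor_sums[OF assms(1), of z] taylor_sums[OF assms(2), of z] assms(3)
      sums_unique2 by fastforce
qed

lemma taylor_coeff_lincomb:
  assumes f: "f \<in> entire_functions" and g: "g \<in> entire_functions"
  shows "taylor_coeff (\<lambda>z. c * f z + d * g z) n = c * taylor_coeff f n + d * taylor_coeff g n"
proof -
  have cf: "(\<lambda>z. c * f z) holomorphic_on UNIV" "(\<lambda>z. d * g z) holomorphic_on UNIV"
    using f g by (auto simp: entire_functions_def intro!: holomorphic_intros)
  have "(deriv ^^ n) (\<lambda>z. c * f z + d * g z) 0
      = (deriv ^^ n) (\<lambda>z. c * f z) 0 + (deriv ^^ n) (\<lambda>z. d * g z) 0"
    by (rule higher_deriv_add[of _ UNIV]) (use cf in auto)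
  also have "\<dots> = c * (deriv ^^ n) f 0 + d * (deriv ^^ n) g 0"
    using higher_deriv_cmult[of f UNIV 0] higher_deriv_cmult[of g UNIV 0] f g
    by (simp add: entire_functions_def)
  finally show ?thesis by (simp add: taylor_coeff_def add_divide_distrib)
qed

lemma taylor_coeff_zero [simp]: "taylor_coeff (\<lambda>z. 0) n = 0"
  by (simp add: taylor_coeff_def)

lemma taylor_coeff_sum:
  assumes "finite I" "\<And>i. i \<in> I \<Longrightarrow> f i \<in> entire_functions"
  shows "taylor_coeff (\<lambda>z. \<Sum>i\<in>I. c i * f i z) n = (\<Sum>i\<in>I. c i * taylor_coeff (f i) n)"
  using assms
proof (induction I rule: finite_induct)
  case (insert x F)
  then show ?case
    using taylor_coeff_lincomb[of "f x" "\<lambda>z. \<Sum>i\<in>F. c i * f i z" "c x" 1 n]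
      entire_sum[of F f c] by simp
qed simp

lemma taylor_coeff_bound:
  assumes f: "f \<in> entire_functions" and b: "disc_bound r f b" and r: "r > 0"
  shows "norm (taylor_coeff f n) \<le> b / r ^ n"
proof -
  have "norm ((deriv ^^ n) f 0) \<le> fact n * b / r ^ n"
    by (rule Cauchy_inequality) (use assms in \<open>auto simp: disc_bound_def
      intro: entire_holomorphic entire_continuous\<close>)
  then show ?thesis by (simp add: taylor_coeff_def norm_divide field_simps)
qed

lemma higher_deriv_poly: "(deriv ^^ n) (poly p) = poly ((pderiv ^^ n) p)" for p :: "complex poly"
  by (induction n) (auto intro!: ext DERIV_imp_deriv poly_DERIV)

lemma taylor_coeff_poly [simp]: "taylor_coeff (poly p) n = coeff p n"
proof -
  have "poly ((pderiv ^^ n) p) 0 = coeff ((pderiv ^^ n) p) 0" by (simp add: poly_0_coeff_0)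
  also have "\<dots> = fact n * coeff p n"
    by (simp add: coeff_higher_pderiv pochhammer_fact)
  finally show ?thesis by (simp add: taylor_coeff_def higher_deriv_poly)
qed

section \<open>Approximation by polynomials\<close>

text \<open>The value at \<open>0\<close> is preserved because the approximants are Taylor polynomials; this later
  keeps the lowest coefficient of a seed equal to \<open>1\<close>.\<close>

lemma entire_poly_approx:
  assumes f: "f \<in> entire_functions" and e: "e > 0"
  obtains p :: "complex poly" where "poly p 0 = f 0" "disc_bound r (\<lambda>z. poly p z - f z) e"
proof -
  define A where "A = taylor_coeff f"
  define S where "S n = (\<Sum>i<n. monom (A i) i)" for n
  have S: "poly (S n) z = (\<Sum>i<n. A i * z ^ i)" for n z
    by (simp add: S_def poly_sum poly_monom)
  have "summable (\<lambda>n. A n * z ^ n)" for z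
    using taylor_sums[OF f] unfolding A_def by (rule sums_summable)
  then have "norm (of_real t :: complex) \<le> conv_radius A" for t
    by (intro conv_radius_geI)
  from this[of "\<bar>r\<bar> + 1"] have "ereal (\<bar>r\<bar> + 1) \<le> conv_radius A"
    by (simp only: norm_of_real abs_add_one_gt_zero abs_of_pos)
  then have "ereal r < conv_radius A"
    by (rule less_le_trans[rotated]) auto
  from powser_uniform_limit[OF this, of 0]
  have "uniform_limit (cball 0 r) (\<lambda>n z. poly (S n) z) (\<lambda>z. \<Sum>i. A i * z ^ i) sequentially"
    by (simp add: S)
  moreover have "(\<lambda>z. \<Sum>i. A i * z ^ i) = f"
    using taylor_sums[OF f] by (auto simp: A_def intro!: ext sums_unique[symmetric])
  ultimately have "uniform_limit (cball 0 r) (\<lambda>n z. poly (S n) z) f sequentially" by simp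
  then have "\<forall>\<^sub>F n in sequentially. \<forall>z\<in>cball 0 r. dist (poly (S n) z) (f z) < e"
    using e by (simp add: uniform_limit_iff)
  then have "\<forall>\<^sub>F n in sequentially. n \<ge> 1 \<and> (\<forall>z\<in>cball 0 r. dist (poly (S n) z) (f z) < e)"
    by (intro eventually_conj eventually_ge_at_top)
  then obtain n where n: "n \<ge> 1" "\<forall>z\<in>cball 0 r. dist (poly (S n) z) (f z) < e"
    using eventually_happens' sequentially_bot by blast
  have "poly (S n) 0 = f 0"
  proof -
    obtain k where "n = Suc k" using n(1) by (cases n) auto
    then have "poly (S n) 0 = A 0"
      by (simp add: S sum.lessThan_Suc_shift)
    then show ?thesis by (simp add: A_def taylor_coeff_def)
  qed
  moreover have "disc_bound r (\<lambda>z. poly (S n) z - f z) e"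
    using n(2) by (auto simp: disc_bound_def dist_norm intro: less_imp_le)
  ultimately show thesis by (rule that)
qed

text \<open>Encoding the coefficients by a list of pairs of rationals makes the countability of the set
  of targets a matter of its type.\<close>

definition rational_poly :: "(rat \<times> rat) list \<Rightarrow> complex poly" where
  "rational_poly xs = Poly (map (\<lambda>(x, y). Complex (of_rat x) (of_rat y)) xs)"

lemma rational_complex_dense:
  fixes w :: complex
  assumes "e > 0"
  obtains x y :: rat where "norm (Complex (of_rat x) (of_rat y) - w) < e"
proof -
  obtain x where x: "Re w - e / 2 < of_rat x" "of_rat x < Re w"
    using of_rat_dense[of "Re w - e/2" "Re w"] assms by auto
  obtain y where y: "Im w - e / 2 < of_rat y" "of_rat y < Im w"
    using of_rat_dense[of "Im w - e/2" "Im w"] assms by auto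
  have "norm (Complex (of_rat x) (of_rat y) - w) \<le> \<bar>of_rat x - Re w\<bar> + \<bar>of_rat y - Im w\<bar>"
    using cmod_le[of "Complex (of_rat x) (of_rat y) - w"] by simp
  also have "\<dots> < e" using x y by simp
  finally show thesis by (rule that)
qed

lemma rational_poly_dense_poly:
  assumes "e > 0"
  shows "\<exists>xs. disc_bound r (\<lambda>z. poly (rational_poly xs) z - poly p z) e"
  using assms
proof (induction p arbitrary: e)
  case 0
  then show ?case by (intro exI[of _ "[]"]) (simp add: rational_poly_def disc_bound_def)
next
  case (pCons c p)
  define R where "R = max 1 r"
  have R: "R \<ge> 1" "R \<ge> r" by (auto simp: R_def)
  obtain x y where xy: "norm (Complex (of_rat x) (of_rat y) - c) < e / 2"
    using rational_complex_dense[of "e/2"] pCons by auto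
  obtain xs where xs: "disc_bound r (\<lambda>z. poly (rational_poly xs) z - poly p z) (e / (2 * R))"
    using pCons.IH[of "e / (2 * R)"] pCons.prems R by auto
  have "norm (poly (rational_poly ((x,y) # xs)) z - poly (pCons c p) z) \<le> e" if z: "norm z \<le> r" for z
  proof -
    have "poly (rational_poly ((x,y) # xs)) z - poly (pCons c p) z
        = (Complex (of_rat x) (of_rat y) - c) + z * (poly (rational_poly xs) z - poly p z)"
      by (simp add: rational_poly_def algebra_simps)
    also have "norm \<dots> \<le> e / 2 + R * (e / (2 * R))"
    proof (intro norm_triangle_le add_mono)
      show "norm (z * (poly (rational_poly xs) z - poly p z)) \<le> R * (e / (2 * R))"
        unfolding norm_mult using z R xs[THEN disc_boundD, OF z] by (intro mult_mono) auto
    qed (use xy in auto)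
    also have "\<dots> = e" using R by (simp add: field_simps)
    finally show ?thesis .
  qed
  then show ?case by (auto simp: disc_bound_def)
qed

lemma rational_poly_dense:
  assumes "f \<in> entire_functions" "e > 0"
  obtains xs where "disc_bound r (\<lambda>z. poly (rational_poly xs) z - f z) e"
proof -
  obtain p where p: "disc_bound r (\<lambda>z. poly p z - f z) (e/2)"
    using entire_poly_approx[OF assms(1), of "e/2" r] assms(2) by auto
  obtain xs where "disc_bound r (\<lambda>z. poly (rational_poly xs) z - poly p z) (e/2)"
    using rational_poly_dense_poly[of "e/2" r p] assms(2) by auto
  from disc_bound_add[OF this p] show thesis by (intro that[of xs]) simp
qed

text \<open>For entire functions this is convergence in \<open>entire_topology\<close>, since every compact set lies in
  a disc about \<open>0\<close>.\<close>

definition tends_on_discs :: "(nat \<Rightarrow> complex \<Rightarrow> complex) \<Rightarrow> (complex \<Rightarrow> complex) \<Rightarrow> bool" where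
  "tends_on_discs F f \<longleftrightarrow>
     (\<forall>r e. e > 0 \<longrightarrow> (\<forall>\<^sub>F k in sequentially. disc_bound r (\<lambda>z. F k z - f z) e))"

lemma tends_on_discsD:
  "tends_on_discs F f \<Longrightarrow> e > 0 \<Longrightarrow> \<forall>\<^sub>F k in sequentially. disc_bound r (\<lambda>z. F k z - f z) e"
  by (simp add: tends_on_discs_def)

section \<open>Operators on entire functions\<close>

text \<open>The continuous linear operators on the space of entire functions: the last condition is
  continuity, expressed by the seminorms given by suprema over discs.\<close>

definition entire_operator :: "((complex \<Rightarrow> complex) \<Rightarrow> (complex \<Rightarrow> complex)) \<Rightarrow> bool" where
  "entire_operator L \<longleftrightarrow>
     (\<forall>f\<in>entire_functions. L f \<in> entire_functions) \<and>
     (\<forall>f\<in>entire_functions. \<forall>g\<in>entire_functions. \<forall>c d.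
        L (\<lambda>z. c * f z + d * g z) = (\<lambda>z. c * L f z + d * L g z)) \<and>
     (\<forall>r. \<exists>R K. K > 0 \<and> (\<forall>f\<in>entire_functions. \<forall>b. disc_bound R f b \<longrightarrow> disc_bound r (L f) (K * b)))"

context
  fixes L :: "(complex \<Rightarrow> complex) \<Rightarrow> (complex \<Rightarrow> complex)"
  assumes L: "entire_operator L"
begin

lemma operator_entire: "f \<in> entire_functions \<Longrightarrow> L f \<in> entire_functions"
  using L by (simp add: entire_operator_def)

lemma operator_lincomb:
  "f \<in> entire_functions \<Longrightarrow> g \<in> entire_functions \<Longrightarrow>
     L (\<lambda>z. c * f z + d * g z) = (\<lambda>z. c * L f z + d * L g z)"
  using L by (simp add: entire_operator_def)

lemma operator_bound:
  obtains R K where "K > 0"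
    "\<And>f b. f \<in> entire_functions \<Longrightarrow> disc_bound R f b \<Longrightarrow> disc_bound r (L f) (K * b)"
  using L unfolding entire_operator_def by meson

lemma operator_diff:
  "f \<in> entire_functions \<Longrightarrow> g \<in> entire_functions \<Longrightarrow> L (\<lambda>z. f z - g z) = (\<lambda>z. L f z - L g z)"
  using operator_lincomb[of f g 1 "-1"] by simp

lemma operator_add:
  "f \<in> entire_functions \<Longrightarrow> g \<in> entire_functions \<Longrightarrow> L (\<lambda>z. f z + g z) = (\<lambda>z. L f z + L g z)"
  using operator_lincomb[of f g 1 1] by simp

lemma operator_zero: "L (\<lambda>z. 0) = (\<lambda>z. 0)"
  using operator_lincomb[of "\<lambda>z. 0" "\<lambda>z. 0" 0 0] by simp

lemma operator_sum:
  assumes "finite I" "\<And>i. i \<in> I \<Longrightarrow> f i \<in> entire_functions"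
  shows "L (\<lambda>z. \<Sum>i\<in>I. c i * f i z) = (\<lambda>z. \<Sum>i\<in>I. c i * L (f i) z)"
  using assms
proof (induction I rule: finite_induct)
  case (insert x F)
  then show ?case
    using operator_lincomb[of "f x" "\<lambda>z. \<Sum>i\<in>F. c i * f i z" "c x" 1] entire_sum[of F f c] by simp
qed (simp add: operator_zero)

lemma operator_limit:
  assumes F: "\<And>k. F k \<in> entire_functions" and f: "f \<in> entire_functions"
    and lim: "tends_on_discs F f"
  shows "(\<lambda>k. L (F k) z) \<longlonglongrightarrow> L f z"
proof -
  obtain R K where K: "K > 0"
    "\<And>f b. f \<in> entire_functions \<Longrightarrow> disc_bound R f b \<Longrightarrow> disc_bound (norm z) (L f) (K * b)"
    by (rule operator_bound[of "norm z"]) blast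
  show ?thesis
    unfolding tendsto_iff
  proof (intro allI impI)
    fix e :: real assume e: "e > 0"
    have "\<forall>\<^sub>F k in sequentially. disc_bound R (\<lambda>z. F k z - f z) (e / (2 * K))"
      using tends_on_discsD[OF lim, of "e / (2 * K)" R] e K(1) by simp
    then show "\<forall>\<^sub>F k in sequentially. dist (L (F k) z) (L f z) < e"
    proof eventually_elim
      case (elim k)
      have "disc_bound (norm z) (L (\<lambda>z. F k z - f z)) (K * (e / (2 * K)))"
        by (rule K(2)[OF entire_diff[OF F f] elim])
      then have "norm (L (F k) z - L f z) \<le> e / 2"
        using K(1) by (auto simp: operator_diff[OF F f] dest!: disc_boundD[where z = z])
      then show ?case using e by (simp add: dist_norm)
    qed
  qed
qed

end

lemma entire_operator_id: "entire_operator (\<lambda>f. f)"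
  unfolding entire_operator_def
proof (intro conjI ballI allI)
  show "\<exists>R K. K > 0 \<and> (\<forall>f\<in>entire_functions. \<forall>b. disc_bound R f b \<longrightarrow> disc_bound r f (K * b))" for r
    by (intro exI[of _ r] exI[of _ "1::real"]) auto
qed auto

lemma entire_operator_funpow:
  assumes A: "entire_operator A" shows "entire_operator (A ^^ n)"
proof (induction n)
  case 0
  then show ?case using entire_operator_id by (simp add: id_def)
next
  case (Suc n)
  show ?case
    unfolding entire_operator_def
  proof (intro conjI ballI allI)
    fix r
    obtain R K where K: "K > 0"
      "\<And>f b. f \<in> entire_functions \<Longrightarrow> disc_bound R f b \<Longrightarrow> disc_bound r (A f) (K * b)"
      by (rule operator_bound[OF A, of r]) blast
    obtain R' K' where K': "K' > 0"
      "\<And>f b. f \<in> entire_functions \<Longrightarrow> disc_bound R' f b \<Longrightarrow> disc_bound R ((A ^^ n) f) (K' * b)"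
      by (rule operator_bound[OF Suc, of R]) blast
    show "\<exists>R K. K > 0 \<and> (\<forall>f\<in>entire_functions. \<forall>b. disc_bound R f b \<longrightarrow>
            disc_bound r ((A ^^ Suc n) f) (K * b))"
      using K K' operator_entire[OF Suc]
      by (intro exI[of _ R'] exI[of _ "K * K'"]) (simp add: mult.assoc)
  qed (use operator_entire[OF Suc] operator_entire[OF A] operator_lincomb[OF Suc]
        operator_lincomb[OF A] in simp_all)
qed

text \<open>The order \<open>N\<close> of vanishing lets corrections leave the Taylor coefficients fixed that have been
  used so far. The condition holds for all large \<open>n\<close>, not just for some, so that
  finitely many polynomials can be steered by the same power.\<close>

definition steerable :: "((complex \<Rightarrow> complex) \<Rightarrow> (complex \<Rightarrow> complex)) \<Rightarrow> bool" where
  "steerable A \<longleftrightarrow> (\<forall>f p N r e. e > 0 \<longrightarrow> (\<forall>\<^sub>F n in sequentially. \<exists>s.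
     (\<forall>i<N. coeff s i = 0) \<and> disc_bound r (poly s) e \<and>
     disc_bound r (\<lambda>z. (A ^^ n) (poly (f + s)) z - poly p z) e))"

text \<open>The order of the quantifiers matters: \<open>C\<close> is chosen first and serves all powers \<open>n\<close>, whereas
  the exponent \<open>m\<close> may be large depending on \<open>n\<close>.\<close>

definition tames :: "((complex \<Rightarrow> complex) \<Rightarrow> (complex \<Rightarrow> complex)) \<Rightarrow> (complex \<Rightarrow> complex) \<Rightarrow> bool" where
  "tames A h \<longleftrightarrow> (\<forall>r. \<exists>C\<ge>1. \<forall>\<^sub>F n in sequentially. \<forall>\<^sub>F m in sequentially.
     disc_bound r ((A ^^ n) (\<lambda>z. h z ^ m)) (C ^ m))"

section \<open>Translation operators\<close>

lemma translation_funpow: "(translation_op a ^^ n) f = (\<lambda>z. f (z + of_nat n * a))"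
  by (induction n arbitrary: f) (simp_all add: translation_op_def algebra_simps)

lemma entire_operator_translation: "entire_operator (translation_op a)"
  unfolding entire_operator_def
proof (intro conjI ballI allI)
  fix r
  have "disc_bound r (translation_op a f) (1 * b)" if "disc_bound (r + norm a) f b" for f b
    unfolding disc_bound_def translation_op_def
  proof (intro allI impI)
    fix z :: complex assume "norm z \<le> r"
    then have "norm (z + a) \<le> r + norm a" by (intro norm_triangle_le add_mono) auto
    then show "norm (f (z + a)) \<le> 1 * b" using that by (simp add: disc_bound_def)
  qed
  then show "\<exists>R K. K > 0 \<and> (\<forall>f\<in>entire_functions. \<forall>b. disc_bound R f b \<longrightarrow>
      disc_bound r (translation_op a f) (K * b))"
    using zero_less_one by blast
qed (auto simp: translation_op_entire translation_op_linear)

lemma norm_one_plus_power_minus_one: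
  fixes v :: complex shows "norm ((1 + v) ^ M - 1) \<le> (1 + norm v) ^ M - 1"
proof (induction M)
  case (Suc M)
  have "(1 + v) ^ Suc M - 1 = (1 + v) * ((1 + v) ^ M - 1) + v" by (simp add: algebra_simps)
  also have "norm \<dots> \<le> (1 + norm v) * ((1 + norm v) ^ M - 1) + norm v"
    unfolding norm_mult using Suc norm_triangle_ineq[of 1 v]
    by (intro norm_triangle_le add_mono order_refl) (auto simp: norm_mult intro!: mult_mono)
  finally show ?case by (simp add: algebra_simps)
qed simp

text \<open>The polynomial \<open>w \<mapsto> (1 - (1 - w) ^ M) ^ M\<close> is a switch: exponentially small on the disc of
  radius \<open>1 / (3 * M)\<close> about \<open>0\<close>, and exponentially close to \<open>1\<close> on the disc of radius \<open>1/3\<close> about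
  \<open>1\<close>. It is divisible by \<open>w ^ M\<close>. It takes the place of Runge's theorem. Near \<open>0\<close> the inner
  expression is at most \<open>exp (1/3) - 1 < 2/3\<close>.\<close>

lemma switch_near_zero:
  fixes w :: complex assumes w: "norm w * (3 * real M) \<le> 1"
  shows "norm ((1 - (1 - w) ^ M) ^ M) \<le> (2/3) ^ M"
proof -
  have "norm (1 - (1 - w) ^ M) \<le> (1 + norm w) ^ M - 1"
    using norm_one_plus_power_minus_one[of "-w" M] by (simp add: norm_minus_commute)
  also have "(1 + norm w) ^ M \<le> exp (norm w) ^ M"
    by (intro power_mono exp_ge_add_one_self) auto
  also have "\<dots> = exp (real M * norm w)" by (simp add: exp_of_nat_mult)
  also have "\<dots> \<le> exp (1/3)" using w by (simp add: algebra_simps)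
  also have "exp (1/3 :: real) \<le> 1 + 1/3 + (1/3)\<^sup>2" by (rule exp_bound) auto
  finally have "norm (1 - (1 - w) ^ M) \<le> 2/3" by (simp add: power2_eq_square)
  then show ?thesis unfolding norm_power by (intro power_mono) auto
qed

text \<open>By convexity of the power, the graph lies below the chord over the interval from \<open>0\<close> to
  \<open>1\<close>.\<close>

lemma one_plus_power_le_chord:
  fixes x :: real assumes "0 \<le> x" "x \<le> 1"
  shows "(1 + x) ^ M \<le> 1 + x * (2 ^ M - 1)"
proof (induction M)
  case (Suc M)
  have "(1 + x) ^ Suc M \<le> (1 + x) * (1 + x * (2 ^ M - 1))"
    using Suc assms by (simp add: mult_left_mono)
  also have "\<dots> = 1 + x + x * ((1 + x) * (2 ^ M - 1))" by (simp add: algebra_simps)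
  also have "\<dots> \<le> 1 + x + x * (2 * (2 ^ M - 1))"
    using assms by (intro add_left_mono mult_left_mono mult_right_mono) auto
  finally show ?case by (simp add: algebra_simps)
qed simp

lemma switch_near_one:
  fixes w :: complex assumes w: "norm (w - 1) \<le> 1/3"
  shows "norm ((1 - (1 - w) ^ M) ^ M - 1) \<le> (2/3) ^ M"
proof -
  define x where "x = norm ((1 - w) ^ M)"
  have x: "0 \<le> x" "x \<le> (1/3) ^ M"
    using w by (auto simp: x_def norm_power norm_minus_commute intro!: power_mono)
  then have x1: "x \<le> 1" using power_le_one[of "1/3 :: real" M] by simp
  have "norm ((1 - (1 - w) ^ M) ^ M - 1) \<le> (1 + x) ^ M - 1"
    using norm_one_plus_power_minus_one[of "- ((1 - w) ^ M)" M] by (simp add: x_def)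
  also have "\<dots> \<le> x * 2 ^ M"
    using one_plus_power_le_chord[OF x(1) x1, of M] x(1) by (simp add: algebra_simps)
  also have "\<dots> \<le> (1/3) ^ M * 2 ^ M" using x by (intro mult_right_mono) auto
  also have "\<dots> = (2/3) ^ M" by (simp add: power_mult_distrib[symmetric])
  finally show ?thesis .
qed

lemma poly_growth:
  fixes q :: "complex poly"
  obtains B d where "B \<ge> 0" "\<And>z. norm (poly q z) \<le> B * (1 + norm z) ^ d"
proof -
  have "\<exists>B d. B \<ge> 0 \<and> (\<forall>z. norm (poly q z) \<le> B * (1 + norm z) ^ d)"
  proof (induction q)
    case 0
    show ?case by (intro exI[of _ 0]) auto
  next
    case (pCons c q)
    then obtain B d where B: "B \<ge> 0" "\<And>z. norm (poly q z) \<le> B * (1 + norm z) ^ d" by blast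
    have "norm (poly (pCons c q) z) \<le> (norm c + B) * (1 + norm z) ^ Suc d" for z
    proof -
      have "norm (poly (pCons c q) z) \<le> norm c * 1 + norm z * (B * (1 + norm z) ^ d)"
        using B(2)[of z] by (auto intro!: norm_triangle_le add_mono mult_left_mono simp: norm_mult)
      also have "\<dots> \<le> norm c * (1 + norm z) ^ Suc d + (1 + norm z) * (B * (1 + norm z) ^ d)"
        using B(1) by (intro add_mono mult_left_mono mult_right_mono one_le_power) auto
      finally show ?thesis by (simp add: algebra_simps)
    qed
    then show ?case using B(1) by (intro exI[of _ "norm c + B"] exI[of _ "Suc d"]) auto
  qed
  then show thesis using that by blast
qed

lemma coeff_power_eq_0:
  fixes q :: "complex poly"
  assumes "poly q 0 = 0" "i < M" shows "coeff (q ^ M * g) i = 0"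
proof -
  have "[:0, 1:] dvd q" using assms(1) poly_eq_0_iff_dvd[of q 0] by simp
  then have "[:0, 1:] ^ M dvd q ^ M * g" by (simp add: dvd_mult2 dvd_power_same)
  then obtain t where "q ^ M * g = [:0, 1:] ^ M * t" by (rule dvdE)
  then have "q ^ M * g = monom 1 M * t" by (simp add: monom_altdef)
  then show ?thesis using assms(2) by (simp add: coeff_monom_mult)
qed

lemma exponential_beats_power:
  fixes \<alpha> \<beta> \<gamma> B :: real
  assumes "\<alpha> > 0" "\<beta> > 0" "\<gamma> > 0"
  shows "(\<lambda>n. (2/3) ^ nat \<lfloor>real n * \<beta>\<rfloor> * (B * (\<gamma> + real n * \<alpha>) ^ d)) \<longlonglongrightarrow> 0"
proof -
  define c where "c = ln (3/2 :: real)"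
  have c: "c > 0" by (simp add: c_def)
  have "(\<lambda>n. exp (- k * real n) * (\<gamma> + real n * \<alpha>) powr real d) \<longlonglongrightarrow> 0" if "k > 0" for k
    using assms that by real_asymp
  from this[of "c * \<beta>"] have lim: "(\<lambda>n. exp (- (c * \<beta>) * real n) * (\<gamma> + real n * \<alpha>) powr real d) \<longlonglongrightarrow> 0"
    using c assms by simp
  from tendsto_mult_right_zero[OF this, of "exp c * \<bar>B\<bar>"]
  have lim: "(\<lambda>n. exp c * \<bar>B\<bar> * (exp (- (c * \<beta>) * real n) * (\<gamma> + real n * \<alpha>) ^ d)) \<longlonglongrightarrow> 0"
    using assms by (subst (asm) powr_realpow) (auto intro: add_pos_nonneg)
  show ?thesis
  proof (rule Lim_null_comparison[OF _ lim], intro always_eventually allI)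
    fix n
    have "(2/3 :: real) ^ nat \<lfloor>real n * \<beta>\<rfloor> = exp (- c) ^ nat \<lfloor>real n * \<beta>\<rfloor>"
      by (simp add: c_def exp_minus)
    also have "\<dots> = exp (- c * real (nat \<lfloor>real n * \<beta>\<rfloor>))"
      by (simp add: exp_of_nat_mult[symmetric] mult.commute)
    also have "\<dots> \<le> exp (- c * (real n * \<beta> - 1))"
    proof -
      have "real n * \<beta> - 1 \<le> real (nat \<lfloor>real n * \<beta>\<rfloor>)" by linarith
      then have "c * (real n * \<beta> - 1) \<le> c * real (nat \<lfloor>real n * \<beta>\<rfloor>)"
        using c by (intro mult_left_mono) auto
      then show ?thesis by simp
    qed
    also have "\<dots> = exp c * exp (- (c * \<beta>) * real n)"
      by (simp add: exp_add[symmetric] algebra_simps)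
    finally have le: "(2/3) ^ nat \<lfloor>real n * \<beta>\<rfloor> \<le> exp c * exp (- (c * \<beta>) * real n)" .
    have pos: "0 \<le> \<gamma> + real n * \<alpha>" using assms by (simp add: add_nonneg_nonneg)
    have "norm ((2/3) ^ nat \<lfloor>real n * \<beta>\<rfloor> * (B * (\<gamma> + real n * \<alpha>) ^ d))
        = (2/3) ^ nat \<lfloor>real n * \<beta>\<rfloor> * (\<bar>B\<bar> * (\<gamma> + real n * \<alpha>) ^ d)"
      using pos by (simp add: abs_mult)
    also have "\<dots> \<le> exp c * exp (- (c * \<beta>) * real n) * (\<bar>B\<bar> * (\<gamma> + real n * \<alpha>) ^ d)"
      using pos by (intro mult_right_mono le) auto
    finally show "norm ((2/3) ^ nat \<lfloor>real n * \<beta>\<rfloor> * (B * (\<gamma> + real n * \<alpha>) ^ d))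
        \<le> exp c * \<bar>B\<bar> * (exp (- (c * \<beta>) * real n) * (\<gamma> + real n * \<alpha>) ^ d)"
      by (simp add: mult_ac)
  qed
qed

text \<open>Put \<open>c = n * a\<close> and correct \<open>f\<close> by \<open>\<phi> (z / c) * (p (z - c) - f z)\<close>, where \<open>\<phi>\<close> is the switch
  with exponent \<open>M\<close>. Then the errors on both discs are at most \<open>(2/3) ^ M\<close> times a polynomial in
  \<open>n\<close>. The exponent can be taken proportional to \<open>n\<close>, since the disc of radius \<open>\<rho>\<close> only has
  to be mapped into the disc of radius \<open>1 / (3 * M)\<close> by \<open>z \<mapsto> z / c\<close>; so the exponential wins.\<close>

lemma steerable_translation:
  assumes a: "a \<noteq> 0" shows "steerable (translation_op a)"
  unfolding steerable_def
proof (intro allI impI)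
  fix f p :: "complex poly" and N :: nat and r e :: real assume e: "e > 0"
  define \<rho> where "\<rho> = max 1 r"
  have \<rho>: "\<rho> \<ge> 1" "r \<le> \<rho>" by (auto simp: \<rho>_def)
  obtain B d where B: "B \<ge> 0" "\<And>z. norm (poly f z) \<le> B * (1 + norm z) ^ d" using poly_growth by blast
  obtain B' d' where B': "B' \<ge> 0" "\<And>z. norm (poly p z) \<le> B' * (1 + norm z) ^ d'" using poly_growth by blast
  define \<beta> where "\<beta> = norm a / (3 * \<rho>)"
  have \<beta>: "\<beta> > 0" using a \<rho> by (simp add: \<beta>_def)
  define M where "M n = nat \<lfloor>real n * \<beta>\<rfloor>" for n
  define X where "X n = 1 + \<rho> + real n * norm a" for n
  define E where "E n = (2/3) ^ M n * (B * X n ^ d) + (2/3) ^ M n * (B' * X n ^ d')" for n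
  have "E \<longlonglongrightarrow> 0 + 0"
    unfolding E_def M_def X_def using a \<beta> \<rho> by (intro tendsto_add exponential_beats_power) auto
  then have "\<forall>\<^sub>F n in sequentially. E n < e" using e by (simp add: order_tendstoD(2))
  moreover have "filterlim M sequentially sequentially"
    unfolding M_def using \<beta> by real_asymp
  then have "\<forall>\<^sub>F n in sequentially. M n \<ge> N" by (simp add: filterlim_at_top)
  ultimately show "\<forall>\<^sub>F n in sequentially. \<exists>s. (\<forall>i<N. coeff s i = 0) \<and> disc_bound r (poly s) e \<and>
      disc_bound r (\<lambda>z. (translation_op a ^^ n) (poly (f + s)) z - poly p z) e"
    using eventually_gt_at_top[of 0]
  proof eventually_elim
    case (elim n)
    define c where "c = of_nat n * a"
    have c: "c \<noteq> 0" "norm c = real n * norm a" using elim a by (auto simp: c_def norm_mult)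
    have M: "real (M n) \<le> norm c / (3 * \<rho>)"
      using \<beta> \<rho> a by (auto simp: M_def c \<beta>_def)
    define \<phi> where "\<phi> = (1 - [:1, - 1 / c:] ^ M n) ^ M n"
    have \<phi>: "poly \<phi> z = (1 - (1 - z / c) ^ M n) ^ M n" for z
      by (simp add: \<phi>_def)
    define g where "g = pcompose p [:- c, 1:] - f"
    have g: "poly g z = poly p (z - c) - poly f z" for z
      by (simp add: g_def poly_pcompose)
    \<comment> \<open>The common form of both errors, with \<open>w\<close> the error of the switch.\<close>
    have small: "norm w \<le> (2/3) ^ M n \<Longrightarrow> norm x \<le> norm c + \<rho> \<Longrightarrow> norm y \<le> norm c + \<rho>
        \<Longrightarrow> norm (w * (poly p x - poly f y)) \<le> e" for w x y
    proof -
      assume w: "norm w \<le> (2/3) ^ M n" and x: "norm x \<le> norm c + \<rho>" and y: "norm y \<le> norm c + \<rho>"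
      have "norm (poly p x - poly f y) \<le> norm (poly p x) + norm (poly f y)" by (rule norm_triangle_ineq4)
      also have "\<dots> \<le> B' * (1 + norm x) ^ d' + B * (1 + norm y) ^ d" by (intro add_mono B B')
      also have "\<dots> \<le> B' * X n ^ d' + B * X n ^ d"
        using x y c B B' by (intro add_mono mult_left_mono power_mono) (auto simp: X_def)
      finally have "norm (w * (poly p x - poly f y)) \<le> (2/3) ^ M n * (B' * X n ^ d' + B * X n ^ d)"
        unfolding norm_mult using w by (intro mult_mono) auto
      also have "\<dots> = E n" by (simp add: E_def algebra_simps)
      finally show ?thesis using elim by simp
    qed
    define s where "s = \<phi> * g"
    have "coeff s i = 0" if "i < N" for i
      unfolding s_def \<phi>_def by (rule coeff_power_eq_0) (use that elim in auto)
    moreover have "disc_bound r (poly s) e"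
      unfolding disc_bound_def s_def poly_mult g
    proof (intro allI impI small)
      fix z :: complex assume z: "norm z \<le> r"
      have "norm (z / c) * (3 * real (M n)) \<le> \<rho> / norm c * (3 * (norm c / (3 * \<rho>)))"
        unfolding norm_divide using z \<rho> M by (intro mult_mono divide_right_mono) auto
      also have "\<dots> = 1" using \<rho> c(1) by simp
      finally show "norm (poly \<phi> z) \<le> (2/3) ^ M n" unfolding \<phi> by (rule switch_near_zero)
      show "norm (z - c) \<le> norm c + \<rho>" using norm_triangle_ineq4[of z c] z \<rho> by simp
      show "norm z \<le> norm c + \<rho>" using z \<rho> by (simp add: add_increasing)
    qed
    moreover have "disc_bound r (\<lambda>z. (translation_op a ^^ n) (poly (f + s)) z - poly p z) e"
      unfolding disc_bound_def
    proof (intro allI impI)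
      fix z :: complex assume z: "norm z \<le> r"
      have eq: "(translation_op a ^^ n) (poly (f + s)) z - poly p z
          = (poly \<phi> (z + c) - 1) * (poly p z - poly f (z + c))"
        by (simp add: translation_funpow s_def g flip: c_def) (simp add: algebra_simps)
      \<comment> \<open>For \<open>M n = 0\<close> the switch is constantly \<open>1\<close>, and its argument need not be close to \<open>1\<close>.\<close>
      have M1: "norm (z / c) \<le> 1/3" if "M n > 0"
      proof -
        have "1 \<le> real (M n)" using that by simp
        then have "1 \<le> norm c / (3 * \<rho>)" using M by linarith
        then have "3 * \<rho> \<le> norm c" using \<rho> by (simp add: field_simps)
        then show ?thesis using z \<rho> c(1) by (simp add: norm_divide field_simps)
      qed
      have "norm (poly \<phi> (z + c) - 1) \<le> (2/3) ^ M n"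
      proof (cases "M n = 0")
        case False
        have "(z + c) / c - 1 = z / c" using c(1) by (simp add: field_simps)
        then show ?thesis unfolding \<phi> using False M1 by (intro switch_near_one) simp
      qed (simp add: \<phi>)
      then show "norm ((translation_op a ^^ n) (poly (f + s)) z - poly p z) \<le> e"
        unfolding eq
      proof (rule small)
        show "norm (z + c) \<le> norm c + \<rho>" using norm_triangle_ineq[of z c] z \<rho> by simp
        show "norm z \<le> norm c + \<rho>" using z \<rho> by (simp add: add_increasing)
      qed
    qed
    ultimately show ?case by blast
  qed
qed

text \<open>At \<open>z + n * a\<close> the exponential contributes the factor \<open>exp (- n)\<close>, which beats the linear
  growth of the factor \<open>z\<close>. So \<open>h\<close> itself is bounded by \<open>1\<close> on the translated disc.\<close>

lemma tames_translation:
  assumes a: "a \<noteq> 0" shows "tames (translation_op a) (\<lambda>z. z * exp (- z / a))"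
  unfolding tames_def
proof (intro allI exI[of _ 1] conjI order_refl)
  fix r :: real
  have "(\<lambda>n. (r + real n * norm a) * (exp (- real n) * exp (r / norm a))) \<longlonglongrightarrow> 0"
    by real_asymp
  then have "\<forall>\<^sub>F n in sequentially. (r + real n * norm a) * (exp (- real n) * exp (r / norm a)) < 1"
    by (rule order_tendstoD) simp
  then show "\<forall>\<^sub>F n in sequentially. \<forall>\<^sub>F m in sequentially.
      disc_bound r ((translation_op a ^^ n) (\<lambda>z. (z * exp (- z / a)) ^ m)) (1 ^ m)"
  proof eventually_elim
    case (elim n)
    have "norm ((z + of_nat n * a) * exp (- (z + of_nat n * a) / a)) \<le> 1" if z: "norm z \<le> r" for z
    proof -
      have "- (z + of_nat n * a) / a = - of_nat n + (- z / a)" using a by (simp add: field_simps)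
      moreover have "norm (exp (- z / a)) \<le> exp (r / norm a)"
      proof -
        have "Re (- z / a) \<le> norm (- z / a)" by (rule complex_Re_le_cmod)
        also have "\<dots> \<le> r / norm a" using z by (simp add: norm_divide divide_right_mono)
        finally show ?thesis by (simp add: norm_exp_eq_Re)
      qed
      moreover have "norm (exp (- of_nat n :: complex)) = exp (- real n)"
        by (simp add: norm_exp_eq_Re)
      ultimately have ez: "norm (exp (- (z + of_nat n * a) / a)) \<le> exp (- real n) * exp (r / norm a)"
        by (simp only: exp_add norm_mult) (intro mult_left_mono, auto)
      have nz: "norm (z + of_nat n * a) \<le> r + real n * norm a"
        using z by (intro norm_triangle_le add_mono) (auto simp: norm_mult)
      have "norm ((z + of_nat n * a) * exp (- (z + of_nat n * a) / a))
          \<le> (r + real n * norm a) * (exp (- real n) * exp (r / norm a))"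
        unfolding norm_mult[of "z + _"]
        by (rule mult_mono[OF nz ez]) (use order_trans[OF norm_ge_zero nz] in auto)
      then show ?thesis using elim by simp
    qed
    then show ?case
      unfolding disc_bound_def translation_funpow norm_power power_one
      by (intro always_eventually allI impI power_le_one norm_ge_zero)
  qed
qed

section \<open>Multiples of differentiation\<close>

lemma scaled_deriv_funpow:
  assumes "f \<in> entire_functions"
  shows "(scaled_deriv_op \<mu> ^^ n) f = (\<lambda>z. \<mu> ^ n * (deriv ^^ n) f z)"
proof (induction n)
  case (Suc n)
  have "(deriv ^^ n) f holomorphic_on UNIV"
    using assms by (auto simp: entire_functions_def intro: holomorphic_higher_deriv)
  then have "deriv (\<lambda>z. \<mu> ^ n * (deriv ^^ n) f z) z = \<mu> ^ n * deriv ((deriv ^^ n) f) z" for z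
    by (intro deriv_cmult holomorphic_on_imp_differentiable_at[of _ UNIV]) auto
  then show ?case using Suc by (simp add: scaled_deriv_op_def)
qed simp

lemma disc_bound_higher_deriv:
  assumes f: "f \<in> entire_functions" and b: "disc_bound (r + 1) f b"
  shows "disc_bound r ((deriv ^^ n) f) (fact n * b)"
  unfolding disc_bound_def
proof (intro allI impI)
  fix z :: complex assume z: "norm z \<le> r"
  have "norm ((deriv ^^ n) f z) \<le> fact n * b / 1 ^ n"
  proof (rule Cauchy_inequality)
    fix x assume "norm (z - x) = 1"
    then have "norm x \<le> r + 1" using z norm_triangle_ineq3[of z x] by linarith
    then show "norm (f x) \<le> b" using b by (rule disc_boundD[rotated])
  qed (auto intro: entire_holomorphic entire_continuous f)
  then show "norm ((deriv ^^ n) f z) \<le> fact n * b" by simp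
qed

lemma entire_operator_scaled_deriv: "entire_operator (scaled_deriv_op \<mu>)"
  unfolding entire_operator_def
proof (intro conjI ballI allI)
  fix r
  have "disc_bound r (scaled_deriv_op \<mu> f) ((norm \<mu> + 1) * b)"
    if f: "f \<in> entire_functions" and b: "disc_bound (max 0 r + 1) f b" for f b
  proof -
    have "b \<ge> 0" using b by (rule disc_bound_nonneg) simp
    moreover have "disc_bound (max 0 r) ((deriv ^^ 1) f) (fact 1 * b)"
      by (rule disc_bound_higher_deriv[OF f b])
    then have "disc_bound (max 0 r) (deriv f) b" by simp
    then have "disc_bound r (deriv f) b" by (rule disc_bound_mono) auto
    ultimately show ?thesis unfolding scaled_deriv_op_def
      by (intro disc_bound_cmult) auto
  qed
  then show "\<exists>R K. K > 0 \<and> (\<forall>f\<in>entire_functions. \<forall>b. disc_bound R f b \<longrightarrow>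
      disc_bound r (scaled_deriv_op \<mu> f) (K * b))"
    by (intro exI[of _ "max 0 r + 1"] exI[of _ "norm \<mu> + 1"]) (auto simp: add_nonneg_pos)
qed (auto simp: scaled_deriv_op_entire scaled_deriv_op_linear)

text \<open>For \<open>n > degree f\<close> the operator kills \<open>f\<close>, and it maps the \<open>n\<close>-fold antiderivative of
  \<open>p / \<mu> ^ n\<close> exactly to \<open>p\<close>. The antiderivative is small because of \<open>i! * n! \<le> (i + n)!\<close>.\<close>

lemma steerable_scaled_deriv:
  assumes \<mu>: "\<mu> \<noteq> 0" shows "steerable (scaled_deriv_op \<mu>)"
  unfolding steerable_def
proof (intro allI impI)
  fix f p :: "complex poly" and N :: nat and r e :: real assume e: "e > 0"
  define \<rho> where "\<rho> = max 1 r"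
  have \<rho>: "\<rho> \<ge> 1" "r \<le> \<rho>" by (auto simp: \<rho>_def)
  define B where "B = (\<Sum>i\<le>degree p. norm (coeff p i) * \<rho> ^ i)"
  have "(\<lambda>n. inverse (fact n) * (\<rho> / norm \<mu>) ^ n) \<longlonglongrightarrow> 0"
    using summable_exp[of "\<rho> / norm \<mu>"] by (rule summable_LIMSEQ_zero)
  from tendsto_mult_right_zero[OF this, of B]
  have "\<forall>\<^sub>F n in sequentially. B * (inverse (fact n) * (\<rho> / norm \<mu>) ^ n) < e"
    using e by (simp add: order_tendstoD(2))
  then show "\<forall>\<^sub>F n in sequentially. \<exists>s. (\<forall>i<N. coeff s i = 0) \<and> disc_bound r (poly s) e \<and>
      disc_bound r (\<lambda>z. (scaled_deriv_op \<mu> ^^ n) (poly (f + s)) z - poly p z) e"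
    using eventually_gt_at_top[of "degree f"] eventually_gt_at_top[of N]
  proof eventually_elim
    case (elim n)
    define q where "q i = coeff p i * (fact i / (\<mu> ^ n * fact (i + n)))" for i
    define s where "s = (\<Sum>i\<le>degree p. monom (q i) (i + n))"
    have coeff_s: "coeff s k = (\<Sum>i\<le>degree p. if i + n = k then q i else 0)" for k
      by (simp add: s_def coeff_sum coeff_monom)
    have "coeff s i = 0" if "i < N" for i
      unfolding coeff_s by (rule sum.neutral) (use that elim in auto)
    moreover have "disc_bound r (poly s) e"
      unfolding disc_bound_def
    proof (intro allI impI)
      fix z :: complex assume z: "norm z \<le> r"
      have "norm (poly s z) \<le> (\<Sum>i\<le>degree p. norm (q i * z ^ (i + n)))"
        by (simp add: s_def poly_sum poly_monom norm_sum)
      also have "\<dots> \<le> (\<Sum>i\<le>degree p. norm (coeff p i) * \<rho> ^ i * (inverse (fact n) * (\<rho> / norm \<mu>) ^ n))"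
      proof (rule sum_mono)
        fix i
        have "fact i * fact n \<le> (fact (i + n) :: nat)"
          by (intro dvd_imp_le fact_fact_dvd_fact) auto
        then have "real (fact i * fact n) \<le> real (fact (i + n))" by (rule of_nat_mono)
        then have fact: "fact i / fact (i + n) \<le> (inverse (fact n) :: real)"
          by (simp add: field_simps)
        have "norm (q i * z ^ (i + n)) = norm (coeff p i) * ((fact i / fact (i + n)) / norm \<mu> ^ n) * norm z ^ (i + n)"
          by (simp add: q_def norm_mult norm_divide norm_power)
        also have "\<dots> \<le> norm (coeff p i) * (inverse (fact n) / norm \<mu> ^ n) * \<rho> ^ (i + n)"
          using z \<rho> fact by (intro mult_mono mult_left_mono divide_right_mono power_mono) auto
        also have "\<dots> = norm (coeff p i) * \<rho> ^ i * (inverse (fact n) * (\<rho> / norm \<mu>) ^ n)"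
          by (simp add: power_add power_divide field_simps)
        finally show "norm (q i * z ^ (i + n))
            \<le> norm (coeff p i) * \<rho> ^ i * (inverse (fact n) * (\<rho> / norm \<mu>) ^ n)" .
      qed
      also have "\<dots> = B * (inverse (fact n) * (\<rho> / norm \<mu>) ^ n)"
        by (simp add: B_def sum_distrib_right)
      finally show "norm (poly s z) \<le> e" using elim by simp
    qed
    moreover have "(pderiv ^^ n) (f + s) = smult (1 / \<mu> ^ n) p"
    proof (rule poly_eqI)
      fix k
      have "coeff s (k + n) = (\<Sum>i\<le>degree p. if i = k then q i else 0)"
        unfolding coeff_s by (rule sum.cong) auto
      also have "\<dots> = q k" by (auto simp: q_def coeff_eq_0)
      finally have fs: "coeff (f + s) (k + n) = q k" using elim by (simp add: coeff_eq_0)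
      have "fact k * pochhammer (of_nat (Suc k)) n = (fact (k + n) :: complex)"
        using pochhammer_product'[of "1 :: complex" k n] by (simp add: pochhammer_fact)
      then have "pochhammer (of_nat (Suc k)) n = (fact (k + n) / fact k :: complex)"
        by (simp add: field_simps)
      then show "coeff ((pderiv ^^ n) (f + s)) k = coeff (smult (1 / \<mu> ^ n) p) k"
        unfolding coeff_higher_pderiv fs using \<mu> by (simp add: q_def)
    qed
    then have "(scaled_deriv_op \<mu> ^^ n) (poly (f + s)) = poly p"
      using \<mu> by (simp add: scaled_deriv_funpow higher_deriv_poly del: poly_add)
    then have "disc_bound r (\<lambda>z. (scaled_deriv_op \<mu> ^^ n) (poly (f + s)) z - poly p z) e"
      using e by (simp add: disc_bound_def)
    ultimately show ?case by blast
  qed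
qed

text \<open>Cauchy's inequality costs a factor \<open>\<bar>\<mu>\<bar> ^ n * n!\<close>, which is at most \<open>2 ^ m\<close> for large \<open>m\<close>.\<close>

lemma tames_scaled_deriv:
  assumes h: "h \<in> entire_functions" shows "tames (scaled_deriv_op \<mu>) h"
  unfolding tames_def
proof
  fix r :: real
  obtain B where B: "B \<ge> 1" "disc_bound (r + 1) h B" using entire_disc_bound_ex[OF h] by blast
  have hm: "(\<lambda>z. h z ^ m) \<in> entire_functions" for m
    using h by (auto simp: entire_functions_def intro: holomorphic_intros)
  have "\<forall>\<^sub>F m in sequentially. disc_bound r ((scaled_deriv_op \<mu> ^^ n) (\<lambda>z. h z ^ m)) ((2 * B) ^ m)" for n
  proof -
    have "(\<lambda>m. norm \<mu> ^ n * fact n * (1/2) ^ m) \<longlonglongrightarrow> 0"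
      by (intro tendsto_mult_right_zero LIMSEQ_power_zero) auto
    then have "\<forall>\<^sub>F m in sequentially. norm \<mu> ^ n * fact n * (1/2) ^ m < 1"
      by (rule order_tendstoD) simp
    then show ?thesis
    proof eventually_elim
      case (elim m)
      then have le: "norm \<mu> ^ n * fact n \<le> 2 ^ m" by (simp add: field_simps)
      have "disc_bound (r + 1) (\<lambda>z. h z ^ m) (B ^ m)"
        using B by (auto simp: disc_bound_def norm_power intro!: power_mono)
      from disc_bound_higher_deriv[OF hm this]
      have "disc_bound r (\<lambda>z. \<mu> ^ n * (deriv ^^ n) (\<lambda>z. h z ^ m) z) (norm \<mu> ^ n * (fact n * B ^ m))"
        using B by (intro disc_bound_cmult) (auto simp: norm_power)
      moreover have "norm \<mu> ^ n * (fact n * B ^ m) \<le> (2 * B) ^ m"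
        using le B by (simp add: power_mult_distrib mult_right_mono mult.assoc[symmetric])
      ultimately show ?case
        unfolding scaled_deriv_funpow[OF hm] by (rule disc_bound_mono[OF _ order_refl])
    qed
  qed
  then show "\<exists>C\<ge>1. \<forall>\<^sub>F n in sequentially. \<forall>\<^sub>F m in sequentially.
      disc_bound r ((scaled_deriv_op \<mu> ^^ n) (\<lambda>z. h z ^ m)) (C ^ m)"
    using B(1) by (intro exI[of _ "2 * B"]) auto
qed

section \<open>Closures in the space of entire functions\<close>

lemma tends_on_discs_lincomb:
  assumes "tends_on_discs F f" "tends_on_discs G g"
  shows "tends_on_discs (\<lambda>k z. c * F k z + d * G k z) (\<lambda>z. c * f z + d * g z)"
  unfolding tends_on_discs_def
proof (intro allI impI)
  fix r e :: real assume e: "e > 0"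
  define b where "b = e / (norm c + norm d + 1)"
  have pos: "norm c + norm d + 1 > 0" by (intro add_nonneg_pos) auto
  have b: "b > 0" using e pos by (simp add: b_def)
  show "\<forall>\<^sub>F k in sequentially. disc_bound r (\<lambda>z. c * F k z + d * G k z - (c * f z + d * g z)) e"
    using tends_on_discsD[OF assms(1) b, of r] tends_on_discsD[OF assms(2) b, of r]
  proof eventually_elim
    case (elim k)
    have "disc_bound r (\<lambda>z. c * (F k z - f z) + d * (G k z - g z)) (norm c * b + norm d * b)"
      using elim b by (intro disc_bound_add disc_bound_cmult) auto
    moreover have "norm c * b + norm d * b \<le> e"
    proof -
      have "norm c * b + norm d * b \<le> (norm c + norm d + 1) * b" using b by (simp add: algebra_simps)
      also have "\<dots> = e" using pos by (simp add: b_def)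
      finally show ?thesis .
    qed
    ultimately show ?case by (auto intro: disc_bound_mono simp: algebra_simps)
  qed
qed

lemma taylor_coeff_limit:
  assumes F: "\<And>k. F k \<in> entire_functions" and f: "f \<in> entire_functions" and lim: "tends_on_discs F f"
  shows "(\<lambda>k. taylor_coeff (F k) n) \<longlonglongrightarrow> taylor_coeff f n"
  unfolding tendsto_iff
proof (intro allI impI)
  fix e :: real assume e: "e > 0"
  show "\<forall>\<^sub>F k in sequentially. dist (taylor_coeff (F k) n) (taylor_coeff f n) < e"
    using tends_on_discsD[OF lim half_gt_zero[OF e], of 1]
  proof eventually_elim
    case (elim k)
    have "norm (taylor_coeff (\<lambda>z. F k z - f z) n) \<le> e / 2 / 1 ^ n"
      by (rule taylor_coeff_bound[OF entire_diff[OF F f] elim]) simp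
    also have "taylor_coeff (\<lambda>z. F k z - f z) n = taylor_coeff (F k) n - taylor_coeff f n"
      using taylor_coeff_lincomb[OF F[of k] f, of 1 "-1"] by simp
    finally show ?case using e by (simp add: dist_norm)
  qed
qed

text \<open>Sequences suffice because the discs of radius \<open>k\<close> with tolerance \<open>1 / (k + 1)\<close> give a
  countable neighbourhood base.\<close>

lemma in_entire_closure_iff:
  assumes S: "S \<subseteq> entire_functions"
  shows "f \<in> entire_topology closure_of S \<longleftrightarrow>
    f \<in> entire_functions \<and> (\<exists>F. (\<forall>k. F k \<in> S) \<and> tends_on_discs F f)"
proof (intro iffI conjI)
  assume f: "f \<in> entire_topology closure_of S"
  then show fe: "f \<in> entire_functions" by (simp add: in_closure_of)
  have "\<exists>g\<in>S. disc_bound (real k) (\<lambda>z. g z - f z) (inverse (real (Suc k)))" for k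
  proof -
    let ?U = "{g \<in> entire_functions. \<forall>z\<in>cball 0 (real k). dist (g z) (f z) < inverse (real (Suc k))}"
    have "openin entire_topology ?U" by (intro openin_entire_basic fe compact_cball)
    moreover have "f \<in> ?U" using fe by simp
    ultimately obtain g where "g \<in> S" "g \<in> ?U" using f unfolding in_closure_of by meson
    then show ?thesis by (intro bexI[of _ g]) (auto simp: disc_bound_def dist_norm intro!: less_imp_le)
  qed
  then obtain F where F: "\<And>k. F k \<in> S"
    "\<And>k. disc_bound (real k) (\<lambda>z. F k z - f z) (inverse (real (Suc k)))" by metis
  have "tends_on_discs F f"
    unfolding tends_on_discs_def
  proof (intro allI impI)
    fix r e :: real assume "e > 0"
    then have "\<forall>\<^sub>F k in sequentially. inverse (real (Suc k)) < e"
      using LIMSEQ_inverse_real_of_nat by (rule order_tendstoD(2)[rotated])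
    moreover have "\<forall>\<^sub>F k in sequentially. r \<le> real k"
      using filterlim_real_sequentially by (simp add: filterlim_at_top)
    ultimately show "\<forall>\<^sub>F k in sequentially. disc_bound r (\<lambda>z. F k z - f z) e"
      by eventually_elim (rule disc_bound_mono[OF F(2)], auto)
  qed
  then show "\<exists>F. (\<forall>k. F k \<in> S) \<and> tends_on_discs F f" using F(1) by blast
next
  assume "f \<in> entire_functions \<and> (\<exists>F. (\<forall>k. F k \<in> S) \<and> tends_on_discs F f)"
  then obtain F where f: "f \<in> entire_functions" and F: "\<And>k. F k \<in> S" and lim: "tends_on_discs F f"
    by blast
  show "f \<in> entire_topology closure_of S"
    unfolding in_closure_of
  proof (intro conjI allI impI)
    fix U assume U: "f \<in> U \<and> openin entire_topology U"
    then obtain K e where K: "compact K" "e > 0"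
      "{g \<in> entire_functions. \<forall>z\<in>K. dist (g z) (f z) < e} \<subseteq> U"
      unfolding openin_entire_topology by (elim conjE) (rule entire_openE)
    obtain r where r: "\<And>z. z \<in> K \<Longrightarrow> norm z \<le> r"
      using compact_imp_bounded[OF K(1)] bounded_iff by metis
    obtain k where k: "disc_bound r (\<lambda>z. F k z - f z) (e / 2)"
      using eventually_happens'[OF sequentially_bot tends_on_discsD[OF lim half_gt_zero[OF K(2)], of r]] by blast
    have "dist (F k z) (f z) < e" if "z \<in> K" for z
      using disc_boundD[OF k r[OF that]] K(2) by (simp add: dist_norm)
    then have "F k \<in> U" using K(3) F S by blast
    then show "\<exists>y. y \<in> S \<and> y \<in> U" using F by blast
  qed (use f in simp)
qed

lemma sum_fun_apply: "(\<Sum>i\<in>I. F i) z = (\<Sum>i\<in>I. F i z)"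
  for F :: "'i \<Rightarrow> complex \<Rightarrow> complex"
  by (induction I rule: infinite_finite_induct) auto

section \<open>The closed span of a steered sequence\<close>

text \<open>The outcome of the construction, detached from the operators: \<open>L k\<close> is the power chosen at
  stage \<open>k\<close>. It sends the \<open>j k\<close>-th basis function near the target \<open>q k\<close>, if \<open>j k \<le> k\<close>, and the other
  ones up to \<open>k\<close> near \<open>0\<close>; on the later ones there is only an exponential bound in the
  pivot.\<close>

locale hypercyclic_basis =
  fixes f :: "nat \<Rightarrow> complex \<Rightarrow> complex" and m :: "nat \<Rightarrow> nat"
    and L :: "nat \<Rightarrow> (complex \<Rightarrow> complex) \<Rightarrow> (complex \<Rightarrow> complex)"
    and j :: "nat \<Rightarrow> nat" and q :: "nat \<Rightarrow> complex \<Rightarrow> complex"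
    and C :: "nat \<Rightarrow> nat \<Rightarrow> real"
  assumes f_entire: "f i \<in> entire_functions"
    and coeff_low: "n < m i \<Longrightarrow> taylor_coeff (f i) n = 0"
    and coeff_pivot: "taylor_coeff (f i) (m k) = (if i = k then 1 else 0)"
    and m_gt: "i < m i"
    and L_operator: "entire_operator (L k)"
    and hit: "i \<le> k \<Longrightarrow>
      disc_bound (real k) (\<lambda>z. L k (f i) z - (if i = j k then q k z else 0)) (2 * (1/2) ^ k)"
    and tail: "r \<le> k \<Longrightarrow> k < i \<Longrightarrow> disc_bound (real r) (L k (f i)) (C k r ^ m i)"
    and C_ge: "C k r \<ge> 1"
begin

definition comb :: "nat \<Rightarrow> (nat \<Rightarrow> complex) \<Rightarrow> complex \<Rightarrow> complex" where
  "comb t c = (\<lambda>z. \<Sum>i<t. c i * f i z)"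

definition Combs :: "(complex \<Rightarrow> complex) set" where
  "Combs = {comb t c | t c. True}"

definition M :: "(complex \<Rightarrow> complex) set" where
  "M = entire_topology closure_of Combs"

lemma comb_entire: "comb t c \<in> entire_functions"
  unfolding comb_def by (intro entire_sum f_entire)

lemma Combs_entire: "Combs \<subseteq> entire_functions"
  using comb_entire by (auto simp: Combs_def)

lemma comb_pivot: "taylor_coeff (comb t c) (m i) = (if i < t then c i else 0)"
proof -
  have "taylor_coeff (comb t c) (m i) = (\<Sum>k<t. c k * (if k = i then 1 else 0))"
    unfolding comb_def by (subst taylor_coeff_sum) (auto simp: f_entire coeff_pivot)
  also have "\<dots> = (\<Sum>k<t. if k = i then c k else 0)" by (rule sum.cong) auto
  finally show ?thesis by simp
qed

lemma comb_pad: "t \<le> T \<Longrightarrow> comb t c = comb T (\<lambda>i. if i < t then c i else 0)"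
  unfolding comb_def by (intro ext sum.mono_neutral_cong_left) auto

lemma Combs_lincomb:
  assumes "g \<in> Combs" "h \<in> Combs" shows "(\<lambda>z. c * g z + d * h z) \<in> Combs"
proof -
  obtain t x t' x' where eq: "g = comb t x" "h = comb t' x'" using assms by (auto simp: Combs_def)
  let ?T = "max t t'"
  have g: "g = comb ?T (\<lambda>i. if i < t then x i else 0)" unfolding eq by (rule comb_pad) simp
  have h: "h = comb ?T (\<lambda>i. if i < t' then x' i else 0)" unfolding eq by (rule comb_pad) simp
  have "(\<lambda>z. c * g z + d * h z)
      = comb ?T (\<lambda>i. c * (if i < t then x i else 0) + d * (if i < t' then x' i else 0))"
    unfolding g h unfolding comb_def sum_distrib_left sum.distrib[symmetric]
    by (intro ext sum.cong refl) (simp only: distrib_right mult.assoc)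
  then show ?thesis by (auto simp: Combs_def)
qed

lemma M_iff: "g \<in> M \<longleftrightarrow> g \<in> entire_functions \<and> (\<exists>F. (\<forall>k. F k \<in> Combs) \<and> tends_on_discs F g)"
  unfolding M_def by (rule in_entire_closure_iff[OF Combs_entire])

lemma M_lincomb:
  assumes "g \<in> M" "h \<in> M" shows "(\<lambda>z. c * g z + d * h z) \<in> M"
proof -
  obtain F G where "\<forall>k. F k \<in> Combs" "tends_on_discs F g" "\<forall>k. G k \<in> Combs" "tends_on_discs G h"
    using assms M_iff by blast
  then show ?thesis
    using assms Combs_lincomb tends_on_discs_lincomb[of F g G h c d] entire_lincomb
    unfolding M_iff by (intro conjI exI[of _ "\<lambda>k z. c * F k z + d * G k z"]) auto
qed

lemma Combs_subset_M: "Combs \<subseteq> M"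
  unfolding M_def by (rule closure_of_subset) (simp add: Combs_entire)

lemma f_in_M: "f i \<in> M"
proof -
  have "f i = comb (Suc i) (\<lambda>k. if k = i then 1 else 0)"
    by (simp add: comb_def)
  then show ?thesis using Combs_subset_M by (auto simp: Combs_def)
qed

lemma M_subspace: "cfun.subspace M"
  unfolding cfun.subspace_def
proof (intro conjI ballI allI)
  show "0 \<in> M" using M_lincomb[OF f_in_M f_in_M, of 0 0 0 0] by (simp add: zero_fun_def)
  show "g + h \<in> M" if "g \<in> M" "h \<in> M" for g h
    using M_lincomb[OF that, of 1 1] by (simp add: plus_fun_def)
  show "(\<lambda>z. c * g z) \<in> M" if "g \<in> M" for c g
    using M_lincomb[OF that that, of c 0] by simp
qed

text \<open>The pivot coefficients form a system dual to the functions \<open>f i\<close>, which are therefore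
  linearly independent.\<close>

lemma M_infinite_dimensional: "infinite_dimensional M"
  unfolding infinite_dimensional_def
proof (intro notI, elim exE conjE)
  fix B assume B: "finite B" "M = cfun.span B"
  have inj: "inj f"
  proof (rule injI)
    fix i k assume "f i = f k"
    then show "i = k" using coeff_pivot[of i k] coeff_pivot[of k k] by (auto split: if_splits)
  qed
  have "cfun.independent (range f)"
    unfolding cfun.independent_explicit_finite_subsets
  proof (intro allI impI ballI)
    fix S u v assume S: "S \<subseteq> range f" "finite S"
      and 0: "(\<Sum>v\<in>S. (\<lambda>z. u v * v z)) = 0" and v: "v \<in> S"
    obtain k where k: "v = f k" using S v by blast
    have "(\<lambda>z. \<Sum>w\<in>S. u w * w z) = (\<lambda>z. 0)"
      using 0 by (auto simp: sum_fun_apply fun_eq_iff)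
    then have "0 = taylor_coeff (\<lambda>z. \<Sum>w\<in>S. u w * w z) (m k)" by simp
    also have "\<dots> = (\<Sum>w\<in>S. u w * taylor_coeff w (m k))"
      using S f_entire by (intro taylor_coeff_sum) auto
    also have "\<dots> = (\<Sum>w\<in>S. if w = v then u w else 0)"
    proof (rule sum.cong)
      fix w assume "w \<in> S"
      then obtain i where i: "w = f i" using S by blast
      then show "u w * taylor_coeff w (m k) = (if w = v then u w else 0)"
        using inj unfolding i k by (auto simp: coeff_pivot inj_eq)
    qed simp
    also have "\<dots> = u v" using S v by simp
    finally show "u v = 0" by simp
  qed
  then have "finite (range f)"
    using cfun.independent_span_bound[OF B(1), of "range f"] B(2) f_in_M by auto
  then show False using inj finite_imageD infinite_UNIV_nat by blast
qed

text \<open>On the span, every Taylor coefficient is a finite combination of pivot coefficients: the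
  \<open>n\<close>-th one involves only \<open>i < n\<close>, since \<open>f i\<close> starts in degree \<open>m i > i\<close>. This relation survives
  limits, so the pivot coefficients determine the elements of \<open>M\<close>.\<close>

lemma M_pivot_nonzero:
  assumes g: "g \<in> M" and nz: "g \<noteq> 0"
  obtains i where "taylor_coeff g (m i) \<noteq> 0"
proof (rule ccontr)
  assume "\<not> thesis"
  then have 0: "taylor_coeff g (m i) = 0" for i using that by blast
  obtain F where F: "\<And>k. F k \<in> Combs" and lim: "tends_on_discs F g" and ge: "g \<in> entire_functions"
    using g M_iff by blast
  have Fe: "F k \<in> entire_functions" for k using F Combs_entire by blast
  have rel: "taylor_coeff h n = (\<Sum>i<n. taylor_coeff h (m i) * taylor_coeff (f i) n)"
    if hC: "h \<in> Combs" for h n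
  proof -
    obtain t c where h: "h = comb t c" using hC by (auto simp: Combs_def)
    have "taylor_coeff h n = (\<Sum>i<t. c i * taylor_coeff (f i) n)"
      unfolding h comb_def by (rule taylor_coeff_sum) (auto simp: f_entire)
    also have "\<dots> = (\<Sum>i<t. taylor_coeff h (m i) * taylor_coeff (f i) n)"
      by (rule sum.cong) (auto simp: h comb_pivot)
    also have "\<dots> = (\<Sum>i<max t n. taylor_coeff h (m i) * taylor_coeff (f i) n)"
      by (rule sum.mono_neutral_left) (auto simp: h comb_pivot)
    also have "\<dots> = (\<Sum>i<n. taylor_coeff h (m i) * taylor_coeff (f i) n)"
    proof (rule sum.mono_neutral_right)
      show "\<forall>i\<in>{..<max t n} - {..<n}. taylor_coeff h (m i) * taylor_coeff (f i) n = 0"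
        using m_gt coeff_low by (auto simp: not_less) (meson le_less_trans)
    qed auto
    finally show ?thesis .
  qed
  have "taylor_coeff g n = 0" for n
  proof -
    have "(\<lambda>k. \<Sum>i<n. taylor_coeff (F k) (m i) * taylor_coeff (f i) n)
        \<longlonglongrightarrow> (\<Sum>i<n. taylor_coeff g (m i) * taylor_coeff (f i) n)"
      by (intro tendsto_sum tendsto_mult tendsto_const taylor_coeff_limit[OF Fe ge lim])
    then have "(\<lambda>k. taylor_coeff (F k) n) \<longlonglongrightarrow> 0" by (simp add: rel[OF F, symmetric] 0)
    then show ?thesis using taylor_coeff_limit[OF Fe ge lim, of n] LIMSEQ_unique by blast
  qed
  then have "g = (\<lambda>z. 0)" by (intro entire_eqI_taylor ge) auto
  then show False using nz by (simp add: zero_fun_def)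
qed

text \<open>The coordinates are at most \<open>b / R ^ m i\<close>. For \<open>i \<le> k\<close> they multiply errors of size
  \<open>2 * (1/2) ^ k\<close>; for \<open>i > k\<close> they multiply \<open>C k r ^ m i\<close>, and
  \<open>(C k r / R) ^ m i \<le> (1/4) ^ m i \<le> (1/2) ^ i * (1/2) ^ k\<close>. Either way the term is summable over \<open>i\<close>
  with a gain of \<open>(1/2) ^ k\<close>. The point is that the bound does not depend on the length of the
  combination.\<close>

lemma comb_steered:
  assumes h: "h \<in> Combs" and b: "disc_bound R h b" and R: "R \<ge> 4 * C k r"
    and k: "r \<le> k" "j k \<le> k"
  shows "disc_bound (real r) (\<lambda>z. L k h z - taylor_coeff h (m (j k)) * q k z) (4 * b * (1/2) ^ k)"
proof -
  obtain t0 c0 where h0: "h = comb t0 c0" using h by (auto simp: Combs_def)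
  define t where "t = max t0 (Suc k)"
  define c where "c i = taylor_coeff h (m i)" for i
  have R2: "R \<ge> 2" using R C_ge[of k r] by simp
  have b0: "b \<ge> 0" using b by (rule disc_bound_nonneg) (use R2 in simp)
  have "comb t0 c0 = comb t (\<lambda>i. if i < t0 then c0 i else 0)"
    by (rule comb_pad) (simp add: t_def)
  also have "(\<lambda>i. if i < t0 then c0 i else 0) = c"
    by (rule ext) (simp add: c_def h0 comb_pivot)
  finally have hc: "h = comb t c" by (simp add: h0)
  have c_le: "norm (c i) \<le> b / R ^ m i" for i
    unfolding c_def by (rule taylor_coeff_bound[OF _ b]) (use h Combs_entire R2 in auto)
  have c2: "norm (c i) \<le> b * (1/2) ^ i" for i
  proof -
    have "(2::real) ^ i \<le> 2 ^ m i" by (rule power_increasing) (use m_gt[of i] in auto)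
    also have "\<dots> \<le> R ^ m i" using R2 by (intro power_mono) auto
    finally have "b / R ^ m i \<le> b / 2 ^ i" using b0 R2 by (intro divide_left_mono) auto
    then show ?thesis using c_le[of i] by (simp add: power_one_over)
  qed
  have cC: "norm (c i) * C k r ^ m i \<le> b * (1/2) ^ i * (2 * (1/2) ^ k)" if "k < i" for i
  proof -
    have "norm (c i) * C k r ^ m i \<le> b / R ^ m i * C k r ^ m i"
      using c_le C_ge[of k r] by (intro mult_right_mono) auto
    also have "\<dots> = b * (C k r / R) ^ m i" by (simp add: power_divide)
    also have "\<dots> \<le> b * ((1/2) ^ i * (1/2) ^ k)"
    proof (intro mult_left_mono b0)
      have "(C k r / R) ^ m i \<le> (1/4) ^ m i"
        using R R2 C_ge[of k r] by (intro power_mono) (auto simp: field_simps)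
      also have "(1/4 :: real) ^ m i = (1/2) ^ m i * (1/2) ^ m i"
        by (simp flip: power_mult_distrib)
      also have "\<dots> \<le> (1/2) ^ i * (1/2) ^ k"
        using m_gt[of i] that by (intro mult_mono power_decreasing) auto
      finally show "(C k r / R) ^ m i \<le> (1/2) ^ i * (1/2) ^ k" .
    qed
    also have "\<dots> \<le> b * (1/2) ^ i * (2 * (1/2) ^ k)" using b0 by simp
    finally show ?thesis .
  qed
  define w where "w i z = L k (f i) z - (if i = j k then q k z else 0)" for i z
  have eq: "L k h z - c (j k) * q k z = (\<Sum>i<t. c i * w i z)" for z
  proof -
    have "(\<Sum>i<t. c i * (if i = j k then q k z else 0)) = (\<Sum>i<t. if i = j k then c i * q k z else 0)"
      by (rule sum.cong) auto
    also have "\<dots> = c (j k) * q k z" using k by (simp add: t_def)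
    finally show ?thesis
      unfolding hc comb_def w_def
      by (subst operator_sum[OF L_operator]) (auto simp: f_entire right_diff_distrib sum_subtractf)
  qed
  define d where "d i = b * (1/2) ^ i * (2 * (1/2) ^ k)" for i
  have "disc_bound (real r) (\<lambda>z. c i * w i z) (d i)" for i
  proof (cases "i \<le> k")
    case True
    have "disc_bound (real r) (w i) (2 * (1/2) ^ k)"
      unfolding w_def by (rule disc_bound_mono[OF hit[OF True]]) (use k in auto)
    then show ?thesis unfolding d_def using c2 by (intro disc_bound_cmult) auto
  next
    case False
    have "disc_bound (real r) (w i) (C k r ^ m i)"
      using tail[of r k i] False k unfolding w_def by auto
    then have "disc_bound (real r) (\<lambda>z. c i * w i z) (norm (c i) * C k r ^ m i)"
      using C_ge[of k r] by (intro disc_bound_cmult) auto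
    then show ?thesis using cC[of i] False by (auto simp: d_def intro: disc_bound_mono)
  qed
  then have "disc_bound (real r) (\<lambda>z. \<Sum>i<t. c i * w i z) (\<Sum>i<t. d i)" by (rule disc_bound_sum)
  moreover have "(\<Sum>i<t. d i) \<le> 4 * b * (1/2) ^ k"
  proof -
    have "(\<Sum>i<n. (1/2 :: real) ^ i) = 2 - 2 * (1/2) ^ n" for n
      by (induction n) auto
    then have geo: "(\<Sum>i<t. (1/2 :: real) ^ i) \<le> 2" by simp
    have "(\<Sum>i<t. d i) = (\<Sum>i<t. (1/2) ^ i) * (b * (2 * (1/2) ^ k))"
      unfolding d_def sum_distrib_right by (rule sum.cong) auto
    also have "\<dots> \<le> 2 * (b * (2 * (1/2) ^ k))"
      using geo b0 by (intro mult_right_mono) auto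
    finally show ?thesis by simp
  qed
  ultimately show ?thesis
    unfolding c_def[symmetric] eq
    by (rule disc_bound_mono[OF _ order_refl])
qed

text \<open>Both sides of the previous bound are continuous, so it extends to the closure.\<close>

lemma M_steered:
  assumes g: "g \<in> M" and b: "disc_bound R g b" and R: "R \<ge> 4 * C k r"
    and k: "r \<le> k" "j k \<le> k"
  shows "disc_bound (real r) (\<lambda>z. L k g z - taylor_coeff g (m (j k)) * q k z) (4 * b * (1/2) ^ k)"
  unfolding disc_bound_def
proof (intro allI impI)
  fix z :: complex assume z: "norm z \<le> real r"
  obtain F where F: "\<And>k. F k \<in> Combs" and lim: "tends_on_discs F g" and ge: "g \<in> entire_functions"
    using g M_iff by blast
  have Fe: "F k \<in> entire_functions" for k using F Combs_entire by blast
  have "(\<lambda>t. L k (F t) z - taylor_coeff (F t) (m (j k)) * q k z)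
      \<longlonglongrightarrow> L k g z - taylor_coeff g (m (j k)) * q k z"
    by (intro tendsto_intros operator_limit[OF L_operator Fe ge lim] taylor_coeff_limit[OF Fe ge lim])
  then have lim1: "(\<lambda>t. norm (L k (F t) z - taylor_coeff (F t) (m (j k)) * q k z))
      \<longlonglongrightarrow> norm (L k g z - taylor_coeff g (m (j k)) * q k z)" by (rule tendsto_norm)
  have le: "norm (L k g z - taylor_coeff g (m (j k)) * q k z) \<le> 4 * (b + e) * (1/2) ^ k" if e: "e > 0" for e
  proof (rule tendsto_upperbound[OF lim1])
    show "\<forall>\<^sub>F t in sequentially.
        norm (L k (F t) z - taylor_coeff (F t) (m (j k)) * q k z) \<le> 4 * (b + e) * (1/2) ^ k"
      using tends_on_discsD[OF lim e, of R]
    proof eventually_elim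
      case (elim t)
      have "disc_bound R (F t) (b + e)" using disc_bound_add[OF b elim] by simp
      from comb_steered[OF F this R k] show ?case by (rule disc_boundD) (rule z)
    qed
  qed simp
  show "norm (L k g z - taylor_coeff g (m (j k)) * q k z) \<le> 4 * b * (1/2) ^ k"
  proof (rule field_le_epsilon)
    fix e :: real assume e: "e > 0"
    have "4 * (b + e / 4) * (1/2) ^ k \<le> 4 * b * (1/2) ^ k + e * 1"
      using e by (simp only: distrib_left distrib_right) (simp add: mult_left_mono power_le_one)
    then show "norm (L k g z - taylor_coeff g (m (j k)) * q k z) \<le> 4 * b * (1/2) ^ k + e"
      using le[of "e / 4"] e by simp
  qed
qed

text \<open>Visiting every pair of an index and a rational polynomial at arbitrarily late stages suffices:
  if the \<open>i\<close>-th coordinate \<open>c\<close> of \<open>g\<close> is not \<open>0\<close>, then \<open>h\<close> is approximated by steering towards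
  \<open>h / c\<close>. The constant function \<open>c\<close> of the radius in the assumption expresses that the exponential
  bounds do not change from one visit to the next.\<close>

lemma M_hypercyclic:
  assumes A: "entire_operator A"
    and visits: "\<And>i xs K. \<exists>k\<ge>K. j k = i \<and> q k = poly (rational_poly xs) \<and> (\<exists>n. L k = A ^^ n) \<and> C k = c"
    and g: "g \<in> M" "g \<noteq> 0"
  shows "hypercyclic entire_topology A g"
  unfolding hypercyclic_def
proof (intro conjI)
  have ge: "g \<in> entire_functions" using g(1) M_iff by blast
  then show "g \<in> topspace entire_topology" by simp
  have orbit: "(A ^^ n) g \<in> entire_functions" for n
    by (rule operator_entire[OF entire_operator_funpow[OF A] ge])
  have "h \<in> entire_topology closure_of {(A ^^ n) g |n. True}" if h: "h \<in> entire_functions" for h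
    unfolding in_closure_of
  proof (intro conjI allI impI)
    show "h \<in> topspace entire_topology" using h by simp
    fix U assume U: "h \<in> U \<and> openin entire_topology U"
    then obtain K e where K: "compact K" "e > 0"
      "{g \<in> entire_functions. \<forall>z\<in>K. dist (g z) (h z) < e} \<subseteq> U"
      unfolding openin_entire_topology by (elim conjE) (rule entire_openE)
    obtain r' where r': "\<And>z. z \<in> K \<Longrightarrow> norm z \<le> r'"
      using compact_imp_bounded[OF K(1)] bounded_iff by metis
    define r where "r = nat \<lceil>r'\<rceil>"
    have r: "norm z \<le> real r" if "z \<in> K" for z
      using r'[OF that] real_nat_ceiling_ge[of r'] by (simp add: r_def)
    obtain i where i: "taylor_coeff g (m i) \<noteq> 0" using M_pivot_nonzero[OF g] .
    let ?c = "taylor_coeff g (m i)"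
    have "(\<lambda>z. (1 / ?c) * h z + 0 * h z) \<in> entire_functions" by (intro entire_lincomb h)
    then have "(\<lambda>z. h z / ?c) \<in> entire_functions" by simp
    moreover have "e / 4 / norm ?c > 0" using K(2) i by simp
    ultimately obtain xs where
      xs: "disc_bound (real r) (\<lambda>z. poly (rational_poly xs) z - h z / ?c) (e / 4 / norm ?c)"
      by (rule rational_poly_dense)
    obtain b where b: "b \<ge> 1" "disc_bound (4 * c r) g b" using entire_disc_bound_ex[OF ge] by blast
    have "(\<lambda>k. 4 * b * (1/2) ^ k) \<longlonglongrightarrow> 0"
      by (intro tendsto_mult_right_zero LIMSEQ_power_zero) auto
    then have "\<forall>\<^sub>F k in sequentially. 4 * b * (1/2) ^ k < e / 2"
      using K(2) by (intro order_tendstoD(2)) auto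
    then obtain k0 where k0: "\<And>k. k \<ge> k0 \<Longrightarrow> 4 * b * (1/2) ^ k < e / 2"
      by (auto simp: eventually_sequentially)
    obtain k n where k: "k \<ge> max k0 (max r i)" "j k = i" "q k = poly (rational_poly xs)"
      "L k = A ^^ n" "C k = c" using visits by meson
    have "disc_bound (real r) (\<lambda>z. L k g z - taylor_coeff g (m (j k)) * q k z) (4 * b * (1/2) ^ k)"
      by (rule M_steered[OF g(1) b(2)]) (use k in auto)
    then have steer: "disc_bound (real r) (\<lambda>z. (A ^^ n) g z - ?c * poly (rational_poly xs) z) (4 * b * (1/2) ^ k)"
      by (simp add: k)
    have "dist ((A ^^ n) g z) (h z) < e" if z: "z \<in> K" for z
    proof -
      have "(A ^^ n) g z - h z = ((A ^^ n) g z - ?c * poly (rational_poly xs) z)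
          + ?c * (poly (rational_poly xs) z - h z / ?c)"
        using i by (simp add: algebra_simps)
      also have "norm \<dots> \<le> 4 * b * (1/2) ^ k + norm ?c * (e / 4 / norm ?c)"
        unfolding norm_mult[symmetric]
      proof (intro norm_triangle_le add_mono)
        show "norm ((A ^^ n) g z - ?c * poly (rational_poly xs) z) \<le> 4 * b * (1/2) ^ k"
          by (rule disc_boundD[OF steer r[OF z]])
        show "norm (?c * (poly (rational_poly xs) z - h z / ?c)) \<le> norm ?c * (e / 4 / norm ?c)"
          unfolding norm_mult by (intro mult_left_mono disc_boundD[OF xs r[OF z]]) auto
      qed
      also have "norm ?c * (e / 4 / norm ?c) = e / 4" using i by simp
      finally show ?thesis using k0[of k] k(1) K(2) by (simp add: dist_norm)
    qed
    then have "(A ^^ n) g \<in> U" using K(3) orbit by blast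
    then show "\<exists>y. y \<in> {(A ^^ n) g |n. True} \<and> y \<in> U" by blast
  qed
  then show "entire_topology closure_of {(A ^^ n) g |n. True} = topspace entire_topology"
    using closure_of_subset_topspace[of entire_topology] by auto
qed

end

section \<open>The inductive construction\<close>

text \<open>The increments are summable, so the sequence is uniformly Cauchy on every disc.\<close>

lemma entire_limit:
  assumes G: "\<And>k. G k \<in> entire_functions"
    and step: "\<And>k. i \<le> k \<Longrightarrow> disc_bound (real k) (\<lambda>z. G (Suc k) z - G k z) ((1/2) ^ k)"
  obtains f where "f \<in> entire_functions" "tends_on_discs G f"
proof -
  have tele: "disc_bound (real k) (\<lambda>z. G K z - G k z) (2 * (1/2) ^ k - 2 * (1/2) ^ K)"
    if "i \<le> k" "k \<le> K" for k K
    using \<open>k \<le> K\<close>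
  proof (induction K rule: dec_induct)
    case base
    show ?case by (simp add: disc_bound_def)
  next
    case (step K)
    have "disc_bound (real k) (\<lambda>z. G (Suc K) z - G K z) ((1/2) ^ K)"
      by (rule disc_bound_mono[OF assms(2)]) (use step that in auto)
    from disc_bound_add[OF step.IH this] show ?case by (simp add: algebra_simps)
  qed
  have near: "disc_bound (real k) (\<lambda>z. G K z - G k z) (2 * (1/2) ^ k)" if "i \<le> k" "k \<le> K" for k K
    by (rule disc_bound_mono[OF tele[OF that] order_refl]) simp
  have small: "\<exists>k0. \<forall>k\<ge>k0. 2 * (1/2) ^ k < e" if "e > 0" for e :: real
  proof -
    have "(\<lambda>k. 2 * (1/2) ^ k :: real) \<longlonglongrightarrow> 0"
      by (intro tendsto_mult_right_zero LIMSEQ_power_zero) auto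
    then have "\<forall>\<^sub>F k in sequentially. 2 * (1/2) ^ k < e" using that by (rule order_tendstoD(2))
    then show ?thesis by (simp add: eventually_sequentially)
  qed
  have "Cauchy (\<lambda>k. G k z)" for z
    unfolding Cauchy_altdef2
  proof (intro allI impI)
    fix e :: real assume "e > 0"
    then obtain k0 where k0: "\<And>k. k \<ge> k0 \<Longrightarrow> 2 * (1/2) ^ k < e" using small by blast
    let ?k = "max k0 (max i (nat \<lceil>norm z\<rceil>))"
    have "norm z \<le> real ?k" by (rule order_trans[OF real_nat_ceiling_ge]) simp
    then have "norm (G K z - G ?k z) < e" if "?k \<le> K" for K
      using near[of ?k K, THEN disc_boundD, of z] k0[of ?k] that by force
    then show "\<exists>N. \<forall>n\<ge>N. dist (G n z) (G N z) < e" unfolding dist_norm by blast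
  qed
  then have "\<exists>l. (\<lambda>k. G k z) \<longlonglongrightarrow> l" for z by (simp add: Cauchy_convergent_iff convergent_def)
  then obtain f where f: "\<And>z. (\<lambda>k. G k z) \<longlonglongrightarrow> f z" by metis
  have near_f: "disc_bound (real k) (\<lambda>z. G k z - f z) (2 * (1/2) ^ k)" if "i \<le> k" for k
    unfolding disc_bound_def
  proof (intro allI impI)
    fix z :: complex assume z: "norm z \<le> real k"
    have "(\<lambda>K. norm (G k z - G K z)) \<longlonglongrightarrow> norm (G k z - f z)" by (intro tendsto_intros f)
    moreover have "\<forall>\<^sub>F K in sequentially. norm (G k z - G K z) \<le> 2 * (1/2) ^ k"
      using eventually_ge_at_top[of k]
      by eventually_elim (use near[OF that, THEN disc_boundD, OF _ z] in \<open>simp add: norm_minus_commute\<close>)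
    ultimately show "norm (G k z - f z) \<le> 2 * (1/2) ^ k"
      by (rule tendsto_upperbound) simp
  qed
  have tends: "tends_on_discs G f"
    unfolding tends_on_discs_def
  proof (intro allI impI)
    fix r e :: real assume "e > 0"
    then obtain k0 where k0: "\<And>k. k \<ge> k0 \<Longrightarrow> 2 * (1/2) ^ k < e" using small by blast
    show "\<forall>\<^sub>F k in sequentially. disc_bound r (\<lambda>z. G k z - f z) e"
      using eventually_ge_at_top[of "max k0 (max i (nat \<lceil>r\<rceil>))"]
    proof eventually_elim
      case (elim k)
      then have "r \<le> real k" "i \<le> k" "k0 \<le> k" using real_nat_ceiling_ge[of r] by linarith+
      then show ?case using k0[of k] by (intro disc_bound_mono[OF near_f]) auto
    qed
  qed
  have "f holomorphic_on UNIV"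
  proof (rule holomorphic_uniform_sequence)
    show "G k holomorphic_on UNIV" for k by (intro entire_holomorphic G)
    fix x :: complex
    have "uniform_limit (cball x 1) G f sequentially"
      unfolding uniform_limit_iff
    proof (intro allI impI)
      fix e :: real assume e: "e > 0"
      show "\<forall>\<^sub>F k in sequentially. \<forall>z\<in>cball x 1. dist (G k z) (f z) < e"
        using tends_on_discsD[OF tends half_gt_zero[OF e], of "norm x + 1"]
      proof eventually_elim
        case (elim k)
        have "norm z \<le> norm x + 1" if "z \<in> cball x 1" for z
          using that norm_triangle_ineq2[of z x] by (auto simp: dist_norm norm_minus_commute)
        then show ?case using disc_boundD[OF elim] e by (force simp: dist_norm)
      qed
    qed
    then show "\<exists>d>0. cball x d \<subseteq> UNIV \<and> uniform_limit (cball x d) G f sequentially"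
      by (intro exI[of _ 1]) simp
  qed simp
  then have "f \<in> entire_functions" by (simp add: entire_functions_def)
  then show thesis using tends by (rule that)
qed

text \<open>Later choices must not spoil what the powers chosen earlier do. By continuity it is enough to
  make them small on one large disc.\<close>

lemma operators_small:
  fixes e :: real
  assumes L: "\<And>l. l < k \<Longrightarrow> entire_operator (L l)" and e: "e > 0"
  obtains R \<delta> where "\<delta> > 0" "\<And>f l. f \<in> entire_functions \<Longrightarrow> disc_bound R f \<delta> \<Longrightarrow> l < k \<Longrightarrow>
      disc_bound (real l) (L l f) e"
proof -
  have "\<exists>R \<delta>. \<delta> > 0 \<and> (\<forall>f l. f \<in> entire_functions \<longrightarrow> disc_bound R f \<delta> \<longrightarrow> l < k \<longrightarrow>
      disc_bound (real l) (L l f) e)"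
    using L
  proof (induction k)
    case 0
    show ?case by (intro exI[of _ "1 :: real"]) simp
  next
    case (Suc k)
    obtain R \<delta> where R: "\<delta> > 0" "\<forall>f l. f \<in> entire_functions \<longrightarrow> disc_bound R f \<delta> \<longrightarrow> l < k \<longrightarrow>
        disc_bound (real l) (L l f) e"
      using Suc by (meson less_SucI)
    obtain R' K where K: "K > 0"
      "\<And>f b. f \<in> entire_functions \<Longrightarrow> disc_bound R' f b \<Longrightarrow> disc_bound (real k) (L k f) (K * b)"
      by (rule operator_bound[OF Suc.prems[OF lessI], of "real k"]) blast
    show ?case
    proof (rule exI[of _ "max R R'"], rule exI[of _ "min \<delta> (e / K)"], intro conjI impI allI)
      show "min \<delta> (e / K) > 0" using R(1) K(1) e by simp
      fix f l assume f: "f \<in> entire_functions" and b: "disc_bound (max R R') f (min \<delta> (e / K))"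
        and l: "l < Suc k"
      have b': "disc_bound R f \<delta>" "disc_bound R' f (e / K)" by (rule disc_bound_mono[OF b]; simp)+
      show "disc_bound (real l) (L l f) e"
      proof (cases "l = k")
        case True
        then show ?thesis using K(2)[OF f b'(2)] K(1) by simp
      next
        case False
        then show ?thesis using R(2) f b'(1) l by simp
      qed
    qed
  qed
  then show thesis using that by blast
qed

text \<open>The powers of \<open>z * u z\<close> satisfy the bounds but need not be polynomials. Replacing \<open>u ^ m\<close> by a
  Taylor polynomial, and keeping the factor \<open>z ^ m\<close>, costs at most \<open>1\<close>.\<close>

lemma seed_exists:
  assumes u: "u \<in> entire_functions" "u 0 = 1"
    and L: "\<And>l. l < k \<Longrightarrow> entire_operator (L l)"
    and tame: "\<And>l r. l < k \<Longrightarrow> r \<le> l \<Longrightarrow>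
      \<forall>\<^sub>F m in sequentially. disc_bound (real r) (L l (\<lambda>z. (z * u z) ^ m)) (C l r ^ m)"
  obtains m e where "N < m" "\<And>n. n < m \<Longrightarrow> coeff e n = 0" "coeff e m = 1"
    "\<And>l r. l < k \<Longrightarrow> r \<le> l \<Longrightarrow> disc_bound (real r) (L l (poly e)) (C l r ^ m + 1)"
proof -
  have "\<forall>\<^sub>F m in sequentially. \<forall>l\<in>{..<k}. \<forall>r\<in>{..l}.
      disc_bound (real r) (L l (\<lambda>z. (z * u z) ^ m)) (C l r ^ m)"
    using tame by (intro eventually_ball_finite ballI) auto
  from eventually_conj[OF eventually_gt_at_top[of N] this]
  obtain m where m: "N < m" "\<And>l r. l < k \<Longrightarrow> r \<le> l \<Longrightarrow>
      disc_bound (real r) (L l (\<lambda>z. (z * u z) ^ m)) (C l r ^ m)"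
    using eventually_happens'[OF sequentially_bot] by fastforce
  obtain R \<delta> where R: "\<delta> > 0" "\<And>f l. f \<in> entire_functions \<Longrightarrow> disc_bound R f \<delta> \<Longrightarrow> l < k \<Longrightarrow>
      disc_bound (real l) (L l f) 1"
    by (rule operators_small[OF L zero_less_one]) blast+
  define \<rho> where "\<rho> = max 1 R"
  have \<rho>: "\<rho> \<ge> 1" "R \<le> \<rho>" by (auto simp: \<rho>_def)
  have um: "(\<lambda>z. u z ^ m) \<in> entire_functions" and hm: "(\<lambda>z. (z * u z) ^ m) \<in> entire_functions"
    using u(1) by (auto simp: entire_functions_def intro!: holomorphic_intros)
  obtain t where t: "poly t 0 = u 0 ^ m" "disc_bound R (\<lambda>z. poly t z - u z ^ m) (\<delta> / \<rho> ^ m)"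
    by (rule entire_poly_approx[OF um, of "\<delta> / \<rho> ^ m" R]) (use R(1) \<rho> in auto)
  define e where "e = monom 1 m * t"
  have e: "poly e z - (z * u z) ^ m = z ^ m * (poly t z - u z ^ m)" for z
    by (simp add: e_def poly_monom power_mult_distrib algebra_simps)
  have "disc_bound R (\<lambda>z. poly e z - (z * u z) ^ m) \<delta>"
    unfolding disc_bound_def e
  proof (intro allI impI)
    fix z :: complex assume z: "norm z \<le> R"
    have "norm (z ^ m * (poly t z - u z ^ m)) \<le> \<rho> ^ m * (\<delta> / \<rho> ^ m)"
      unfolding norm_mult norm_power using z \<rho> disc_boundD[OF t(2) z]
      by (intro mult_mono power_mono) auto
    then show "norm (z ^ m * (poly t z - u z ^ m)) \<le> \<delta>" using \<rho> by simp
  qed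
  note close = R(2)[OF entire_diff[OF entire_poly hm] this]
  show thesis
  proof (rule that[OF m(1)])
    show "coeff e n = 0" if "n < m" for n using that by (simp add: e_def coeff_monom_mult)
    show "coeff e m = 1" using t(1) u(2) by (simp add: e_def coeff_monom_mult poly_0_coeff_0)
    fix l r assume l: "l < k" "r \<le> l"
    have "disc_bound (real r) (\<lambda>z. L l (poly e) z - L l (\<lambda>z. (z * u z) ^ m) z) 1"
      using disc_bound_mono[OF close[OF l(1)], of "real r" 1] l
      by (simp add: operator_diff[OF L[OF l(1)] entire_poly hm])
    from disc_bound_add[OF m(2)[OF l] this]
    show "disc_bound (real r) (L l (poly e)) (C l r ^ m + 1)" by simp
  qed
qed

lemma corrections_exist:
  assumes L: "\<And>l. l < k \<Longrightarrow> entire_operator (L l)"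
    and A: "steerable A" and G: "\<forall>\<^sub>F n in sequentially. G n" and e: "e > 0"
  obtains n s where "G n" "\<And>i n. i \<le> k \<Longrightarrow> n \<le> N \<Longrightarrow> coeff (s i) n = 0"
    "\<And>i. i \<le> k \<Longrightarrow> disc_bound (real k) (poly (s i)) e"
    "\<And>i l. i \<le> k \<Longrightarrow> l < k \<Longrightarrow> disc_bound (real l) (L l (poly (s i))) e"
    "\<And>i. i \<le> k \<Longrightarrow> disc_bound (real k) (\<lambda>z. (A ^^ n) (poly (g i + s i)) z - poly (q i) z) e"
proof -
  obtain R \<delta> where R: "\<delta> > 0" "\<And>f l. f \<in> entire_functions \<Longrightarrow> disc_bound R f \<delta> \<Longrightarrow> l < k \<Longrightarrow>
      disc_bound (real l) (L l f) e"
    by (rule operators_small[OF L e]) blast+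
  let ?r = "max R (real k)" and ?e = "min \<delta> e"
  have "\<forall>\<^sub>F n in sequentially. \<forall>i\<in>{..k}. \<exists>s. (\<forall>n<Suc N. coeff s n = 0) \<and> disc_bound ?r (poly s) ?e \<and>
      disc_bound ?r (\<lambda>z. (A ^^ n) (poly (g i + s)) z - poly (q i) z) ?e"
  proof (intro eventually_ball_finite ballI)
    fix i
    have "?e > 0" using e R(1) by simp
    then show "\<forall>\<^sub>F n in sequentially. \<exists>s. (\<forall>n<Suc N. coeff s n = 0) \<and> disc_bound ?r (poly s) ?e \<and>
        disc_bound ?r (\<lambda>z. (A ^^ n) (poly (g i + s)) z - poly (q i) z) ?e"
      using A unfolding steerable_def by blast
  qed simp
  from eventually_happens'[OF sequentially_bot eventually_conj[OF G this]]
  obtain n where n: "G n" "\<forall>i\<in>{..k}. \<exists>s. (\<forall>n<Suc N. coeff s n = 0) \<and> disc_bound ?r (poly s) ?e \<and>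
      disc_bound ?r (\<lambda>z. (A ^^ n) (poly (g i + s)) z - poly (q i) z) ?e" by blast
  from bchoice[OF n(2)] obtain s where s: "\<And>i. i \<le> k \<Longrightarrow> (\<forall>n<Suc N. coeff (s i) n = 0) \<and>
      disc_bound ?r (poly (s i)) ?e \<and>
      disc_bound ?r (\<lambda>z. (A ^^ n) (poly (g i + s i)) z - poly (q i) z) ?e" by auto
  show thesis
  proof (rule that[of n s])
    fix i assume i: "i \<le> k"
    note si = s[OF i]
    show "coeff (s i) n = 0" if "n \<le> N" for n using si that by simp
    show "disc_bound (real k) (poly (s i)) e" by (rule disc_bound_mono[of ?r _ ?e]) (use si in auto)
    show "disc_bound (real k) (\<lambda>z. (A ^^ n) (poly (g i + s i)) z - poly (q i) z) e"
      by (rule disc_bound_mono[of ?r _ ?e]) (use si in auto)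
    have "disc_bound R (poly (s i)) \<delta>" by (rule disc_bound_mono[of ?r _ ?e]) (use si in auto)
    then show "disc_bound (real l) (L l (poly (s i))) e" if "l < k" for l using R(2) that by simp
  qed (rule n)
qed

text \<open>The choices made at stage \<open>k\<close>: the degree and the polynomial from which the \<open>k\<close>-th basis
  function starts, the exponent of the operator of this stage, and the
  polynomials added to the basis functions up to \<open>k\<close>.\<close>

datatype stage = Stage (pivot: nat) (seed: "complex poly") (moment: nat) (correction: "nat \<Rightarrow> complex poly")

text \<open>The \<open>i\<close>-th basis function as it stands before stage \<open>k\<close>, where \<open>i \<le> k\<close>.\<close>

definition stage_sum :: "(nat \<Rightarrow> stage) \<Rightarrow> nat \<Rightarrow> nat \<Rightarrow> complex poly" where
  "stage_sum Y k i = seed (Y i) + (\<Sum>l\<in>{i..<k}. correction (Y l) i)"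

lemma stage_sum_Suc: "i \<le> k \<Longrightarrow> stage_sum Y (Suc k) i = stage_sum Y k i + correction (Y k) i"
  by (simp add: stage_sum_def)

lemma stage_sum_self: "stage_sum Y i i = seed (Y i)"
  by (simp add: stage_sum_def)

locale staged_tasks =
  fixes u :: "complex \<Rightarrow> complex"
    and A :: "nat \<Rightarrow> (complex \<Rightarrow> complex) \<Rightarrow> (complex \<Rightarrow> complex)"
    and p :: "nat \<Rightarrow> complex poly" and j :: "nat \<Rightarrow> nat" and C :: "nat \<Rightarrow> nat \<Rightarrow> real"
  assumes u: "u \<in> entire_functions" "u 0 = 1"
    and A_operator: "entire_operator (A k)" and A_steerable: "steerable (A k)"
    and C_ge_1: "C k r \<ge> 1"
    and A_tames: "\<forall>\<^sub>F n in sequentially. \<forall>\<^sub>F m in sequentially.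
      disc_bound (real r) ((A k ^^ n) (\<lambda>z. (z * u z) ^ m)) (C k r ^ m)"
begin

abbreviation target :: "nat \<Rightarrow> nat \<Rightarrow> complex poly" where
  "target k i \<equiv> (if i = j k then p k else 0)"

text \<open>What stage \<open>k\<close> has to achieve, given the choices of the earlier stages. The conditions say in
  turn: the pivot exceeds all degrees in use; the seed starts at the pivot with coefficient \<open>1\<close>, and
  the earlier powers map it to something exponentially bounded; the corrections do not touch the
  coefficients up to the pivot, are small, and remain small under the earlier powers;
  the new power steers all basis functions up to \<open>k\<close>; and it will allow tame seeds at
  later stages. The value of \<open>Y\<close> at \<open>k\<close> must not occur, hence the case distinction for \<open>i = k\<close>.\<close>

definition admissible :: "(nat \<Rightarrow> stage) \<Rightarrow> nat \<Rightarrow> stage \<Rightarrow> bool" where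
  "admissible Y k s \<longleftrightarrow>
     k < pivot s \<and> (\<forall>l<k. pivot (Y l) < pivot s) \<and> (\<forall>i<k. degree (stage_sum Y k i) < pivot s) \<and>
     (\<forall>n<pivot s. coeff (seed s) n = 0) \<and> coeff (seed s) (pivot s) = 1 \<and>
     (\<forall>l<k. \<forall>r\<le>l. disc_bound (real r) ((A l ^^ moment (Y l)) (poly (seed s))) (C l r ^ pivot s + 1)) \<and>
     (\<forall>i\<le>k. \<forall>n\<le>pivot s. coeff (correction s i) n = 0) \<and>
     (\<forall>i\<le>k. disc_bound (real k) (poly (correction s i)) ((1/2) ^ k)) \<and>
     (\<forall>i\<le>k. \<forall>l<k. disc_bound (real l) ((A l ^^ moment (Y l)) (poly (correction s i))) ((1/2) ^ k)) \<and>
     (\<forall>i\<le>k. disc_bound (real k) (\<lambda>z. (A k ^^ moment s)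
        (poly ((if i = k then seed s else stage_sum Y k i) + correction s i)) z - poly (target k i) z) ((1/2) ^ k)) \<and>
     (\<forall>r\<le>k. \<forall>\<^sub>F m in sequentially.
        disc_bound (real r) ((A k ^^ moment s) (\<lambda>z. (z * u z) ^ m)) (C k r ^ m))"

lemma admissible_cong:
  assumes "\<And>l. l < k \<Longrightarrow> Y l = Y' l"
  shows "admissible Y k s = admissible Y' k s"
proof -
  have "stage_sum Y k i = stage_sum Y' k i" if "i < k" for i
    using assms that by (simp add: stage_sum_def)
  then show ?thesis using assms unfolding admissible_def by (simp cong: conj_cong if_cong)
qed

lemma power_operator: "entire_operator (A k ^^ n)"
  by (rule entire_operator_funpow[OF A_operator])

lemma admissible_extend:
  assumes Y: "\<And>l. l < k \<Longrightarrow> admissible Y l (Y l)"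
  shows "\<exists>s. admissible Y k s"
proof -
  define N where "N = k + (\<Sum>l<k. pivot (Y l)) + (\<Sum>i<k. degree (stage_sum Y k i))"
  have N: "pivot (Y l) \<le> N" "degree (stage_sum Y k l) \<le> N" if "l < k" for l
    using member_le_sum[of l "{..<k}" "\<lambda>l. pivot (Y l)"]
      member_le_sum[of l "{..<k}" "\<lambda>l. degree (stage_sum Y k l)"] that by (auto simp: N_def)
  have kN: "k \<le> N" by (simp add: N_def)
  obtain m e where m: "N < m" "\<And>n. n < m \<Longrightarrow> coeff e n = 0" "coeff e m = 1"
    "\<And>l r. l < k \<Longrightarrow> r \<le> l \<Longrightarrow> disc_bound (real r) ((A l ^^ moment (Y l)) (poly e)) (C l r ^ m + 1)"
  proof (rule seed_exists[OF u, of k "\<lambda>l. A l ^^ moment (Y l)" C N])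
    fix l r assume "l < k" "r \<le> l"
    then show "\<forall>\<^sub>F m in sequentially.
        disc_bound (real r) ((A l ^^ moment (Y l)) (\<lambda>z. (z * u z) ^ m)) (C l r ^ m)"
      using Y[of l] by (simp add: admissible_def)
  qed (use power_operator in blast)+
  have "\<forall>\<^sub>F n in sequentially. \<forall>r\<in>{..k}. \<forall>\<^sub>F m in sequentially.
      disc_bound (real r) ((A k ^^ n) (\<lambda>z. (z * u z) ^ m)) (C k r ^ m)"
    using A_tames by (intro eventually_ball_finite ballI) auto
  then obtain n s where s: "\<forall>r\<in>{..k}. \<forall>\<^sub>F m in sequentially.
      disc_bound (real r) ((A k ^^ n) (\<lambda>z. (z * u z) ^ m)) (C k r ^ m)"
    "\<And>i n. i \<le> k \<Longrightarrow> n \<le> m \<Longrightarrow> coeff (s i) n = 0"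
    "\<And>i. i \<le> k \<Longrightarrow> disc_bound (real k) (poly (s i)) ((1/2) ^ k)"
    "\<And>i l. i \<le> k \<Longrightarrow> l < k \<Longrightarrow> disc_bound (real l) ((A l ^^ moment (Y l)) (poly (s i))) ((1/2) ^ k)"
    "\<And>i. i \<le> k \<Longrightarrow> disc_bound (real k) (\<lambda>z. (A k ^^ n)
        (poly ((if i = k then e else stage_sum Y k i) + s i)) z - poly (target k i) z) ((1/2) ^ k)"
    by (rule corrections_exist[where k = k and L = "\<lambda>l. A l ^^ moment (Y l)" and A = "A k"
          and e = "(1/2) ^ k" and N = m and g = "\<lambda>i. if i = k then e else stage_sum Y k i"
          and q = "target k", OF power_operator A_steerable]) (simp, blast)
  have "admissible Y k (Stage m e n s)"
    unfolding admissible_def stage.sel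
  proof (intro conjI allI impI)
    show "k < m" using kN m(1) by simp
    show "pivot (Y l) < m" "degree (stage_sum Y k l) < m" if "l < k" for l
      using N[OF that] m(1) by simp_all
  qed (use m s in auto)
  then show ?thesis by blast
qed

text \<open>The basis functions are the limits of the stage sums. The corrections after stage \<open>k\<close> add
  up to at most \<open>(1/2) ^ k\<close>, before and after applying \<open>L k\<close>, and all bounds pass to the limit. The
  constant \<open>C k r + 3\<close> absorbs the bound \<open>C k r ^ m + 1\<close> on the seed and the sum of
  the corrections, which is at most \<open>2\<close>.\<close>

theorem basis_exists:
  obtains f m \<nu> where "hypercyclic_basis f m (\<lambda>k. A k ^^ \<nu> k) j (\<lambda>k. poly (p k)) (\<lambda>k r. C k r + 3)"
proof -
  obtain Y where adm: "\<And>k. admissible Y k (Y k)"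
    using dependent_wellorder_choice[of admissible, OF admissible_cong admissible_extend] by blast
  define m where "m k = pivot (Y k)" for k
  define L where "L k = A k ^^ moment (Y k)" for k
  define g where "g = stage_sum Y"
  have L_op: "entire_operator (L k)" for k unfolding L_def by (rule power_operator)
  note adm' = adm[unfolded admissible_def, folded m_def L_def g_def]
  have pivot_gt: "k < m k" and pivot_mono: "l < k \<Longrightarrow> m l < m k"
    and deg: "i < k \<Longrightarrow> degree (g k i) < m k"
    and seed0: "n < m k \<Longrightarrow> coeff (seed (Y k)) n = 0" and seed1: "coeff (seed (Y k)) (m k) = 1"
    and seed_tame: "l < k \<Longrightarrow> r \<le> l \<Longrightarrow> disc_bound (real r) (L l (poly (seed (Y k)))) (C l r ^ m k + 1)"
    and corr0: "i \<le> k \<Longrightarrow> n \<le> m k \<Longrightarrow> coeff (correction (Y k) i) n = 0"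
    and corr_small: "i \<le> k \<Longrightarrow> disc_bound (real k) (poly (correction (Y k) i)) ((1/2) ^ k)"
    and corr_L: "i \<le> k \<Longrightarrow> l < k \<Longrightarrow> disc_bound (real l) (L l (poly (correction (Y k) i))) ((1/2) ^ k)"
    for k l i n r using adm'[of k] by simp_all
  have g_Suc: "g (Suc k) i = g k i + correction (Y k) i" if "i \<le> k" for i k
    unfolding g_def by (rule stage_sum_Suc[OF that])
  have g_self: "g i i = seed (Y i)" for i unfolding g_def by (rule stage_sum_self)
  have steer: "disc_bound (real k) (\<lambda>z. L k (poly (g (Suc k) i)) z - poly (target k i) z) ((1/2) ^ k)"
    if "i \<le> k" for i k
  proof -
    have "g (Suc k) i = (if i = k then seed (Y k) else g k i) + correction (Y k) i"
      using that g_Suc g_self by auto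
    then show ?thesis using adm'[of k] that by metis
  qed
  have "\<exists>f. f \<in> entire_functions \<and> tends_on_discs (\<lambda>k. poly (g k i)) f" for i
  proof -
    have "disc_bound (real k) (\<lambda>z. poly (g (Suc k) i) z - poly (g k i) z) ((1/2) ^ k)" if "i \<le> k" for k
      using corr_small[OF that] by (simp add: g_Suc[OF that])
    from entire_limit[of "\<lambda>k. poly (g k i)", OF entire_poly this] show ?thesis by metis
  qed
  then obtain f where f: "\<And>i. f i \<in> entire_functions" and lim: "\<And>i. tends_on_discs (\<lambda>k. poly (g k i)) (f i)"
    by metis
  have L_g_Suc: "L k (poly (g (Suc K) i)) z = L k (poly (g K i)) z + L k (poly (correction (Y K) i)) z"
    if "i \<le> K" for k K i z
  proof -
    have "poly (g (Suc K) i) = (\<lambda>z. poly (g K i) z + poly (correction (Y K) i) z)"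
      by (simp add: g_Suc[OF that] fun_eq_iff)
    then show ?thesis by (simp add: operator_add[OF L_op entire_poly entire_poly])
  qed
  have coeff_const: "taylor_coeff (f i) n = c" if "\<And>k. K \<le> k \<Longrightarrow> coeff (g k i) n = c" for i n K c
  proof -
    have "(\<lambda>k. coeff (g k i) n) \<longlonglongrightarrow> taylor_coeff (f i) n"
      using taylor_coeff_limit[OF entire_poly f lim, of i n] by simp
    moreover have "(\<lambda>k. coeff (g k i) n) \<longlonglongrightarrow> c"
      by (rule tendsto_eventually, rule eventually_sequentiallyI[of K], rule that)
    ultimately show ?thesis by (rule LIMSEQ_unique)
  qed
  have coeff_stable: "coeff (g k i) n = coeff (g K i) n" if "i \<le> K" "n \<le> m K" "K \<le> k" for i n k K
    using \<open>K \<le> k\<close>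
  proof (induction k rule: dec_induct)
    case (step k)
    have "m K \<le> m k" using pivot_mono[of K k] step by (cases "K = k") auto
    then show ?case using step that by (simp add: g_Suc corr0)
  qed simp
  have low: "taylor_coeff (f i) n = 0" if "n < m i" for i n
    by (rule coeff_const[of i]) (use coeff_stable[of i i n] seed0[OF that] that g_self in auto)
  have "hypercyclic_basis f m (\<lambda>k. A k ^^ moment (Y k)) j (\<lambda>k. poly (p k)) (\<lambda>k r. C k r + 3)"
    unfolding L_def[symmetric]
  proof
    fix i k n r :: nat
    show "f i \<in> entire_functions" "i < m i" "entire_operator (L k)" by (fact f pivot_gt L_op)+
    show "n < m i \<Longrightarrow> taylor_coeff (f i) n = 0" by (rule low)
    show "C k r + 3 \<ge> 1" using C_ge_1[of k r] by simp
    show "taylor_coeff (f i) (m k) = (if i = k then 1 else 0)"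
    proof (cases i k rule: linorder_cases)
      case less
      have "coeff (g l i) (m k) = 0" if "k \<le> l" for l
        using coeff_stable[of i k "m k" l] less that deg[OF less] by (simp add: coeff_eq_0)
      then show ?thesis using less coeff_const[of k] by simp
    next
      case equal
      have "coeff (g l i) (m k) = 1" if "k \<le> l" for l
        using coeff_stable[of i k "m k" l] equal that seed1 g_self by simp
      then show ?thesis using equal coeff_const[of k] by simp
    next
      case greater
      then show ?thesis using low[OF pivot_mono[OF greater]] by simp
    qed
    have L_lim: "disc_bound R (\<lambda>z. L k (f i) z - t z) B"
      if "\<And>K. K0 \<le> K \<Longrightarrow> disc_bound R (\<lambda>z. L k (poly (g K i)) z - t z) B" for K0 R t B
      unfolding disc_bound_def
    proof (intro allI impI)
      fix z :: complex assume z: "norm z \<le> R"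
      have "(\<lambda>K. norm (L k (poly (g K i)) z - t z)) \<longlonglongrightarrow> norm (L k (f i) z - t z)"
        by (intro tendsto_intros operator_limit[OF L_op entire_poly f lim])
      moreover have "\<forall>\<^sub>F K in sequentially. norm (L k (poly (g K i)) z - t z) \<le> B"
        by (rule eventually_sequentiallyI[of K0]) (use disc_boundD[OF that z] in blast)
      ultimately show "norm (L k (f i) z - t z) \<le> B" by (rule tendsto_upperbound) simp
    qed
    show "disc_bound (real k) (\<lambda>z. L k (f i) z - (if i = j k then poly (p k) z else 0)) (2 * (1/2) ^ k)"
      if i: "i \<le> k"
    proof (rule L_lim[of "Suc k"])
      fix K assume "Suc k \<le> K"
      \<comment> \<open>The bound is \<open>(1/2) ^ k + (1/2) ^ (k + 1) + \<dots> + (1/2) ^ (K - 1)\<close> in closed form.\<close>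
      then have "disc_bound (real k) (\<lambda>z. L k (poly (g K i)) z - poly (target k i) z)
          (2 * (1/2) ^ k - 2 * (1/2) ^ K)"
      proof (induction K rule: dec_induct)
        case base
        show ?case using steer[OF i] by simp
      next
        case (step K)
        have iK: "i \<le> K" using step i by simp
        have "disc_bound (real k) (L k (poly (correction (Y K) i))) ((1/2) ^ K)"
          by (rule corr_L) (use step iK in auto)
        from disc_bound_add[OF step.IH this] show ?case by (simp add: L_g_Suc[OF iK] algebra_simps)
      qed
      then have "disc_bound (real k) (\<lambda>z. L k (poly (g K i)) z - poly (target k i) z) (2 * (1/2) ^ k)"
        by (rule disc_bound_mono) auto
      then show "disc_bound (real k) (\<lambda>z. L k (poly (g K i)) z - (if i = j k then poly (p k) z else 0))
          (2 * (1/2) ^ k)" by (simp split: if_splits)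
    qed
    show "disc_bound (real r) (L k (f i)) ((C k r + 3) ^ m i)" if r: "r \<le> k" and k: "k < i"
    proof -
      have "disc_bound (real r) (\<lambda>z. L k (poly (g K i)) z - 0) (C k r ^ m i + 3)" if "i \<le> K" for K
      proof -
        have "disc_bound (real r) (L k (poly (g K i))) (C k r ^ m i + 1 + (2 * (1/2) ^ i - 2 * (1/2) ^ K))"
          using that
        proof (induction K rule: dec_induct)
          case base
          show ?case using seed_tame[OF k r] by (simp add: g_self)
        next
          case (step K)
          have "disc_bound (real k) (L k (poly (correction (Y K) i))) ((1/2) ^ K)"
            by (rule corr_L) (use step k in auto)
          then have "disc_bound (real r) (L k (poly (correction (Y K) i))) ((1/2) ^ K)"
            by (rule disc_bound_mono) (use r in auto)
          from disc_bound_add[OF step.IH this] step show ?case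
            by (simp add: L_g_Suc algebra_simps)
        qed
        moreover have "2 * (1/2) ^ i - 2 * (1/2) ^ K \<le> (2 :: real)"
          using power_le_one[of "1/2 :: real" i] zero_le_power[of "1/2 :: real" K] by linarith
        ultimately show ?thesis by (auto intro: disc_bound_mono)
      qed
      from L_lim[OF this] have "disc_bound (real r) (L k (f i)) (C k r ^ m i + 3)" by simp
      moreover have "C k r ^ m i + 3 \<le> (C k r + 3) ^ m i"
      proof -
        obtain t where t: "m i = Suc t" using pivot_gt[of i] by (cases "m i") auto
        have "C k r * C k r ^ t + 3 * 1 \<le> C k r * (C k r + 3) ^ t + 3 * (C k r + 3) ^ t"
          using C_ge_1[of k r] by (intro add_mono mult_left_mono power_mono one_le_power) auto
        then show ?thesis by (simp add: t algebra_simps)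
      qed
      ultimately show ?thesis by (rule disc_bound_mono[OF _ order_refl])
    qed
  qed
  then show thesis by (rule that)
qed

end

section \<open>Common hypercyclic subspaces\<close>

text \<open>The tasks form a countable set. Decoding \<open>k\<close> as a pair and forgetting the second component
  visits each of them infinitely often.\<close>

theorem common_hypercyclic_subspace_exists:
  assumes u: "u \<in> entire_functions" "u 0 = 1"
    and \<F>: "countable \<F>" "\<F> \<noteq> {}"
    and operator: "\<And>A. A \<in> \<F> \<Longrightarrow> entire_operator A"
    and steer: "\<And>A. A \<in> \<F> \<Longrightarrow> steerable A"
    and tame: "\<And>A. A \<in> \<F> \<Longrightarrow> tames A (\<lambda>z. z * u z)"
  shows "\<exists>M. common_hypercyclic_subspace \<F> M"
proof -
  define good where "good A r C \<longleftrightarrow> C \<ge> 1 \<and> (\<forall>\<^sub>F n in sequentially. \<forall>\<^sub>F m in sequentially.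
      disc_bound (real r) ((A ^^ n) (\<lambda>z. (z * u z) ^ m)) (C ^ m))" for A r and C :: real
  define c where "c A r = (SOME C. good A r C)" for A and r :: nat
  have "\<exists>C. good A r C" if "A \<in> \<F>" for A and r :: nat
    using tame[OF that] unfolding tames_def good_def by blast
  then have good: "good A r (c A r)" if "A \<in> \<F>" for A r
    unfolding c_def by (rule someI_ex) (rule that)
  have c: "c A r \<ge> 1" "\<forall>\<^sub>F n in sequentially. \<forall>\<^sub>F m in sequentially.
      disc_bound (real r) ((A ^^ n) (\<lambda>z. (z * u z) ^ m)) (c A r ^ m)" if "A \<in> \<F>" for A r
    using good[OF that, of r] unfolding good_def by blast+
  define X :: "(((complex \<Rightarrow> complex) \<Rightarrow> (complex \<Rightarrow> complex)) \<times> nat \<times> (rat \<times> rat) list) set"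
    where "X = \<F> \<times> UNIV"
  have X: "countable X" "X \<noteq> {}" using \<F> by (auto simp: X_def)
  define task where "task k = from_nat_into X (fst (prod_decode k))" for k
  have task_in: "task k \<in> X" for k unfolding task_def by (rule from_nat_into[OF X(2)])
  have task_often: "\<exists>k\<ge>K. task k = x" if x: "x \<in> X" for x K
  proof -
    obtain n where "from_nat_into X n = x" using from_nat_into_surj[OF X(1) x] by blast
    then have "task (prod_encode (n, K)) = x" by (simp add: task_def)
    then show ?thesis using le_prod_encode_2[of K n] by blast
  qed
  define A where "A k = fst (task k)" for k
  define j where "j k = fst (snd (task k))" for k
  define p where "p k = rational_poly (snd (snd (task k)))" for k
  have A: "A k \<in> \<F>" for k using task_in[of k] by (auto simp: A_def X_def)
  interpret staged_tasks u A p j "\<lambda>k. c (A k)"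
    by unfold_locales (use u A operator steer c in auto)
  obtain f m \<nu> where "hypercyclic_basis f m (\<lambda>k. A k ^^ \<nu> k) j (\<lambda>k. poly (p k)) (\<lambda>k r. c (A k) r + 3)"
    by (rule basis_exists)
  then interpret hypercyclic_basis f m "\<lambda>k. A k ^^ \<nu> k" j "\<lambda>k. poly (p k)" "\<lambda>k r. c (A k) r + 3" .
  have "hypercyclic entire_topology B g" if g: "g \<in> M - {0}" and B: "B \<in> \<F>" for g B
  proof (rule M_hypercyclic[OF operator[OF B]])
    fix i xs K
    obtain k where k: "k \<ge> K" "task k = (B, i, xs)" using task_often[of "(B, i, xs)" K] B by (auto simp: X_def)
    then show "\<exists>k\<ge>K. j k = i \<and> poly (p k) = poly (rational_poly xs) \<and> (\<exists>n. A k ^^ \<nu> k = B ^^ n) \<and>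
        (\<lambda>r. c (A k) r + 3) = (\<lambda>r. c B r + 3)"
      by (intro exI[of _ k]) (auto simp: A_def j_def p_def)
  qed (use g in auto)
  then show ?thesis
    unfolding common_hypercyclic_subspace_def
    using M_subspace M_infinite_dimensional closedin_closure_of[of entire_topology Combs]
    by (intro exI[of _ M]) (auto simp: M_def)
qed

text \<open>One factor \<open>exp (- z / a)\<close> serves both operators: it decays along the orbit of the translation,
  and for differentiation any entire function will do.\<close>

theorem theorem2p7:
  fixes \<mu> a :: complex
  assumes "\<mu> \<noteq> 0" and "a \<noteq> 0"
  shows "\<exists>M. common_hypercyclic_subspace {scaled_deriv_op \<mu>, translation_op a} M"
proof (rule common_hypercyclic_subspace_exists)
  show "(\<lambda>z. exp (- z / a)) \<in> entire_functions" "exp (- 0 / a) = 1"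
    using assms by (auto simp: entire_functions_def intro!: holomorphic_intros)
  have h: "(\<lambda>z. z * exp (- z / a)) \<in> entire_functions"
    using assms by (auto simp: entire_functions_def intro!: holomorphic_intros)
  fix A assume "A \<in> {scaled_deriv_op \<mu>, translation_op a}"
  then show "entire_operator A" "steerable A" "tames A (\<lambda>z. z * exp (- z / a))"
    using assms h entire_operator_scaled_deriv entire_operator_translation steerable_scaled_deriv
      steerable_translation tames_scaled_deriv tames_translation by auto
qed auto

end
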